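(* Let $\mathrm{XDP}\in\{\mathrm{LDP},\mathrm{SDP}\}$. Let $M_{0,\infty}$ be the submap of the uniform infinite bipolar-oriented triangulation explored by the KMSW procedure after time $0$, and let $\{x_k\}_{k\in\mathbb Z}$ be its boundary vertices, enumerated in directed order (from west to east) so that the root edge is $\lambda_0=(x_0,x_1)$. Almost surely, there exists a unique function $\mathcal X:\mathbb Z\to\mathbb Z$ (called the Busemann function) such that $\mathcal X(0)=0$ and the following is true. Let $k,k'\in\mathbb Z$ and let $\{w_j\}_{j\in\mathbb N}$ be a sequence of distinct vertices of $M_{0,\infty}$ such that for each $j\in\mathbb N$, each of $x_k$ and $x_{k'}$ can be joined to $w_j$ by a directed path in $M_{0,\infty}$ (going from $x_k$, resp. $x_{k'}$, to $w_j$). Then $$\mathcal X(k')-\mathcal X(k)=\mathrm{XDP}_{M_{0,\infty}}(x_{k'},w_j)-\mathrm{XDP}_{M_{0,\infty}}(x_k,w_j)\quad\text{for each sufficiently large } j\in\mathbb N.$$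
   Context: Maps. A planar map is a connected graph (multiple edges allowed) embedded in $\mathbb C$, viewed modulo orientation-preserving homeomorphisms of $\mathbb C$; its external face is the unbounded one. A directed planar map with missing edges is a planar map in which some edges on the boundary of the external face are declared missing; the other edges carry an orientation without directed cycles, while missing edges are unoriented and are not counted as edges of the map. $\mathcal V(\mathfrak m)$ and $\mathcal E(\mathfrak m)$ denote the vertices and the (non-missing) edges; directed paths use only non-missing edges. Left and right are relative to the orientation; maps are drawn with edges oriented from south-west to north-east. KMSW procedure. Let $\mathfrak Z$ be a walk in $\mathbb Z^2$, indexed by $\{0,\dots,n\}$ or $\{0,1,\dots\}$, with increments in $\{(1,-1),(-1,0),(0,1)\}$. Define maps $\mathfrak m_0,\mathfrak m_1,\dots$ with active (non-missing, directed) edges $\lambda_j$ as follows. For each map, the upper-left (resp. lower-right) boundary is the set of non-missing edges on the boundary of the external face with the external face immediately to their left (resp. right); both are directed paths. The upper-right (resp. lower-left) boundary is the set of consecutive missing edges joining the terminal (resp. initial) vertices of these two paths. The active edge is the last edge of the upper-left boundary. $\mathfrak m_0$ is a single directed edge $\lambda_0$. Given $(\mathfrak m_{j-1},\lambda_{j-1})$: (i) if $\mathfrak Z(j)-\mathfrak Z(j-1)=(1,-1)$: if the upper-right boundary is non-empty, its missing edge incident to the terminal vertex of $\lambda_{j-1}$ becomes non-missing, is oriented away from that vertex, and is $\lambda_j$; otherwise a new edge $\lambda_j$ is attached from the terminal vertex of $\lambda_{j-1}$ to a new vertex. (ii) if $\mathfrak Z(j)-\mathfrak Z(j-1)=(-1,0)$: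 glue a new triangle to the left of $\lambda_{j-1}$ with a new active edge $\lambda_j$ having the same terminal vertex as $\lambda_{j-1}$; if there is an edge $e$ of the upper-left boundary immediately preceding $\lambda_{j-1}$, the third edge of the triangle is $e$ and $\lambda_j$ starts at the initial vertex of $e$; otherwise the third edge is a new missing edge joining the initial vertex of $\lambda_{j-1}$ to a new vertex, which is the initial vertex of $\lambda_j$. (iii) if $\mathfrak Z(j)-\mathfrak Z(j-1)=(0,1)$: glue a new triangle to the left of $\lambda_{j-1}$ with a new active edge $\lambda_j$ going from the initial vertex of $\lambda_{j-1}$ to a new vertex; the third edge is a new missing edge joining this new vertex to the terminal vertex of $\lambda_{j-1}$. The output is $\mathfrak m_n$, or the increasing union of the $\mathfrak m_j$ for an infinite walk. Only the increments matter, and the procedure may be started at any integer time $n$, with initial edge $\lambda_n$. UIBOT. Let $\mathcal Z:\mathbb Z\to\mathbb Z^2$ be a bi-infinite walk with i.i.d. increments uniform on $\{(1,-1),(-1,0),(0,1)\}$ and $\mathcal Z(0)=(0,0)$. For $n\in\mathbb Z$ let $M_{n,\infty}$ be the map obtained by applying the KMSW procedure to $\mathcal Z|_{[n,\infty)}$, started from the edge $\lambda_n$. These maps increase as $n$ decreases; their union $M_{-\infty,\infty}$, rooted at $\lambda_0$, is the uniform infinite bipolar-oriented triangulation (UIBOT); equivalently, it is the Benjamini–Schramm local limit of uniform bipolar-oriented triangulations with $n$ edges and fixed left and right boundary lengths, rooted at a uniform edge. $M_{0,\infty}$ is equivalently the submap of the UIBOT lying to the left of $\beta_0^R\cup\{\lambda_0\}\cup\beta_0^L$,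 where $\beta_0^R$ is the rightmost directed path from the terminal vertex of $\lambda_0$ to $\infty$ (its edges and $\lambda_0$ are included) and $\beta_0^L$ is the leftmost directed path from $-\infty$ to the initial vertex of $\lambda_0$ (its vertices are included, its edges are missing). The boundary vertices $\{x_k\}_{k\in\mathbb Z}$ satisfy: for $k\ge 0$, $(x_k,x_{k+1})$ is a directed (non-missing) edge of $M_{0,\infty}$; for $k\le -1$, the boundary edge between $x_k$ and $x_{k+1}$ is missing. Directed distances. $\mathrm{LDP}_{\mathfrak m}(x,y)$ (resp. $\mathrm{SDP}_{\mathfrak m}(x,y)$) is the number of edges of the longest (resp. shortest) directed path in $\mathfrak m$ from $x$ to $y$; if there is no such path, $\mathrm{LDP}_{\mathfrak m}(x,y)=-\infty$ and $\mathrm{SDP}_{\mathfrak m}(x,y)=\infty$. *)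

theory Defs
  imports "HOL-Probability.Probability" "Graph_Theory.Graph_Theory"
begin

section \<open>Directed planar maps with missing edges\<close>

text \<open>
  An edge is given by its two endpoints and the time of the KMSW procedure at which it is
  created; the time distinguishes parallel edges, since two edges created at the same time never
  have the same endpoints. For a missing edge, which is unoriented, the order of the endpoints
  only records the direction from west to east along the boundary it lies on.
\<close>

datatype edge = Edge (birth: nat) (initial_vertex: nat) (terminal_vertex: nat)

text \<open>
  The planar embedding is recorded up to orientation-preserving homeomorphism by the inner faces.
  A face is the pair of its left and right boundary paths, which have the same endpoints:
  the first path is traversed with the face on its right, the second with the face on its left.
  Missing edges are not elements of \<open>edges\<close>.
\<close>

record directed_map =
  vertices :: "nat set"
  edges :: "edge set"
  missing :: "edge set"
  faces :: "(edge list \<times> edge list) set"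

definition digraph_of :: "('z) directed_map_scheme \<Rightarrow> (nat, edge) pre_digraph" where
  "digraph_of m =
     \<lparr>verts = vertices m, arcs = edges m, tail = initial_vertex, head = terminal_vertex\<rparr>"

section \<open>The KMSW procedure\<close>

text \<open>
  The four parts of the boundary of the external face, each listed from west to east: the upper
  boundary of the map is \<open>upper_left @ upper_right\<close>, the lower one is
  \<open>lower_left @ lower_right\<close>. The edges of \<open>upper_right\<close> and \<open>lower_left\<close> are missing.
\<close>

record kmsw_map = directed_map +
  upper_left :: "edge list"
  upper_right :: "edge list"
  lower_left :: "edge list"
  lower_right :: "edge list"

definition active :: "kmsw_map \<Rightarrow> edge" where
  "active m = last (upper_left m)"

definition kmsw_init :: kmsw_map where
  "kmsw_init =
     \<lparr>vertices = {0, 1}, edges = {Edge 0 0 1}, missing = {}, faces = {},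
      upper_left = [Edge 0 0 1], upper_right = [], lower_left = [], lower_right = [Edge 0 0 1]\<rparr>"

definition add_vertex :: "nat \<Rightarrow> kmsw_map \<Rightarrow> kmsw_map" where
  "add_vertex z m = m\<lparr>vertices := insert z (vertices m)\<rparr>"

definition add_edge :: "edge \<Rightarrow> kmsw_map \<Rightarrow> kmsw_map" where
  "add_edge e m = m\<lparr>edges := insert e (edges m), missing := missing m - {e}\<rparr>"

definition add_missing :: "edge \<Rightarrow> kmsw_map \<Rightarrow> kmsw_map" where
  "add_missing e m = m\<lparr>missing := insert e (missing m)\<rparr>"

definition add_face :: "edge list \<Rightarrow> edge list \<Rightarrow> kmsw_map \<Rightarrow> kmsw_map" where
  "add_face l r m = m\<lparr>faces := insert (l, r) (faces m)\<rparr>"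

text \<open>
  Step \<open>(1,-1)\<close>. The missing edge at the terminal vertex of the active edge is the first one of
  \<open>upper_right\<close>, and this vertex is its \<open>initial_vertex\<close> (see \<open>upper_right_first\<close> below), so it
  already carries the required orientation. In the other case the new edge has the external face
  on both of its sides. In all three steps \<open>Suc t\<close> is a fresh name for a vertex.
\<close>

definition kmsw_edge_step :: "nat \<Rightarrow> kmsw_map \<Rightarrow> kmsw_map" where
  "kmsw_edge_step t m =
     (case upper_right m of
        f # fs \<Rightarrow>
          (add_edge f m)\<lparr>upper_left := upper_left m @ [f], upper_right := fs\<rparr>
      | [] \<Rightarrow>
          let new = Edge t (terminal_vertex (active m)) (Suc t)
          in (add_edge new (add_vertex (Suc t) m))
               \<lparr>upper_left := upper_left m @ [new], lower_right := lower_right m @ [new]\<rparr>)"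

text \<open>Step \<open>(-1,0)\<close>.\<close>

definition kmsw_left_step :: "nat \<Rightarrow> kmsw_map \<Rightarrow> kmsw_map" where
  "kmsw_left_step t m =
     (let a = active m; before = butlast (upper_left m)
      in if before \<noteq> [] then
           let e = last before;
               new = Edge t (initial_vertex e) (terminal_vertex a)
           in (add_face [new] [e, a] (add_edge new m))
                \<lparr>upper_left := butlast before @ [new]\<rparr>
         else
           let third = Edge t (Suc t) (initial_vertex a);
               new = Edge t (Suc t) (terminal_vertex a)
           in (add_face [new] [third, a] (add_edge new (add_missing third (add_vertex (Suc t) m))))
                \<lparr>upper_left := [new], lower_left := third # lower_left m\<rparr>)"

text \<open>Step \<open>(0,1)\<close>.\<close>

definition kmsw_right_step :: "nat \<Rightarrow> kmsw_map \<Rightarrow> kmsw_map" where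
  "kmsw_right_step t m =
     (let a = active m;
          new = Edge t (initial_vertex a) (Suc t);
          third = Edge t (Suc t) (terminal_vertex a)
      in (add_face [new, third] [a] (add_edge new (add_missing third (add_vertex (Suc t) m))))
           \<lparr>upper_left := butlast (upper_left m) @ [new], upper_right := third # upper_right m\<rparr>)"

definition kmsw_increments :: "(int \<times> int) set" where
  "kmsw_increments = {(1, -1), (-1, 0), (0, 1)}"

text \<open>On other increments, where the procedure is not defined, the map is left unchanged.\<close>

definition kmsw_step :: "nat \<Rightarrow> int \<times> int \<Rightarrow> kmsw_map \<Rightarrow> kmsw_map" where
  "kmsw_step t d m =
     (if d = (1, -1) then kmsw_edge_step t m
      else if d = (-1, 0) then kmsw_left_step t m
      else if d = (0, 1) then kmsw_right_step t m
      else m)"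

primrec kmsw :: "(nat \<Rightarrow> int \<times> int) \<Rightarrow> nat \<Rightarrow> kmsw_map" where
  "kmsw W 0 = kmsw_init"
| "kmsw W (Suc j) = kmsw_step (Suc j) (W (Suc j) - W j) (kmsw W j)"

text \<open>The increasing union; an edge that is missing at some time may become an edge later on.\<close>

definition kmsw_union :: "(nat \<Rightarrow> int \<times> int) \<Rightarrow> directed_map" where
  "kmsw_union W =
     \<lparr>vertices = (\<Union>j. vertices (kmsw W j)),
      edges = (\<Union>j. edges (kmsw W j)),
      missing = (\<Union>j. missing (kmsw W j)) - (\<Union>j. edges (kmsw W j)),
      faces = (\<Union>j. faces (kmsw W j))\<rparr>"

text \<open>
  The lower boundary only grows during the procedure: \<open>lower_right\<close> at its east end and
  \<open>lower_left\<close> at its west end. For uniform increments both parts are almost surely infinite in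
  the limit, and \<open>boundary_vertex W\<close> then enumerates the vertices of the bi-infinite boundary of
  \<open>kmsw_union W\<close>, from west to east, so that the root edge goes from \<open>boundary_vertex W 0\<close> to
  \<open>boundary_vertex W 1\<close>.
\<close>

definition lower_right_edge :: "(nat \<Rightarrow> int \<times> int) \<Rightarrow> nat \<Rightarrow> edge" where
  "lower_right_edge W i =
     lower_right (kmsw W (LEAST j. i < length (lower_right (kmsw W j)))) ! i"

definition lower_left_edge :: "(nat \<Rightarrow> int \<times> int) \<Rightarrow> nat \<Rightarrow> edge" where
  "lower_left_edge W i =
     rev (lower_left (kmsw W (LEAST j. i < length (lower_left (kmsw W j))))) ! i"

definition boundary_vertex :: "(nat \<Rightarrow> int \<times> int) \<Rightarrow> int \<Rightarrow> nat" where
  "boundary_vertex W k =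
     (if k \<ge> 0 then initial_vertex (lower_right_edge W (nat k))
      else initial_vertex (lower_left_edge W (nat (- k - 1))))"

section \<open>Directed distances\<close>

text \<open>
  A directed path is a sequence of consecutively oriented edges, possibly empty. Its vertices are not
  required to be distinct; in the absence of directed cycles they always are. Since
  \<open>Sup {} = - \<infinity>\<close> and \<open>Inf {} = \<infinity>\<close>, the values for unreachable vertices are the intended ones.
\<close>

definition directed_path :: "('v, 'e) pre_digraph \<Rightarrow> 'v \<Rightarrow> 'e list \<Rightarrow> 'v \<Rightarrow> bool" where
  "directed_path G u p v = pre_digraph.awalk G u p v"

definition LDP :: "('v, 'e) pre_digraph \<Rightarrow> 'v \<Rightarrow> 'v \<Rightarrow> ereal" where
  "LDP G u v = (SUP p \<in> {p. directed_path G u p v}. ereal (real (length p)))"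

definition SDP :: "('v, 'e) pre_digraph \<Rightarrow> 'v \<Rightarrow> 'v \<Rightarrow> ereal" where
  "SDP G u v = (INF p \<in> {p. directed_path G u p v}. ereal (real (length p)))"

section \<open>Consistency of the boundary\<close>

abbreviation edge_chain :: "nat \<Rightarrow> edge list \<Rightarrow> nat \<Rightarrow> bool" where
  "edge_chain \<equiv> pre_digraph.cas \<lparr>verts = UNIV, arcs = UNIV, tail = initial_vertex, head = terminal_vertex\<rparr>"

lemma edge_chain_append:
  "edge_chain u (p @ q) v \<longleftrightarrow> (\<exists>w. edge_chain u p w \<and> edge_chain w q v)"
  by (induction p arbitrary: u) (simp_all add: pre_digraph.cas.simps)

definition boundary_ok :: "kmsw_map \<Rightarrow> bool" where
  "boundary_ok m \<longleftrightarrow>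
     upper_left m \<noteq> [] \<and>
     (\<exists>s t. edge_chain s (upper_left m @ upper_right m) t \<and>
            edge_chain s (lower_left m @ lower_right m) t)"

lemmas kmsw_defs =
  kmsw_edge_step_def kmsw_left_step_def kmsw_right_step_def add_vertex_def add_edge_def
  add_missing_def add_face_def active_def

lemma boundary_ok_step:
  assumes "boundary_ok m"
  shows "boundary_ok (kmsw_step t d m)"
proof -
  obtain us a where ul: "upper_left m = us @ [a]"
    using assms by (metis boundary_ok_def rev_exhaust)
  have "us = [] \<or> (\<exists>vs e. us = vs @ [e])"
    by (cases us rule: rev_cases) auto
  then show ?thesis
    using assms ul
    by (auto simp: boundary_ok_def kmsw_step_def kmsw_defs Let_def edge_chain_append
        pre_digraph.cas.simps split: list.splits) (blast+)?
qed

lemma boundary_ok_kmsw: "boundary_ok (kmsw W j)"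
proof (induction j)
  case 0
  show ?case
    by (auto simp: boundary_ok_def kmsw_init_def pre_digraph.cas.simps)
qed (simp add: boundary_ok_step)

lemma upper_right_first:
  assumes "upper_right (kmsw W j) = f # fs"
  shows "initial_vertex f = terminal_vertex (active (kmsw W j))"
proof -
  obtain us a where "upper_left (kmsw W j) = us @ [a]"
    using boundary_ok_kmsw[of W j] by (metis boundary_ok_def rev_exhaust)
  then show ?thesis
    using boundary_ok_kmsw[of W j] assms
    by (auto simp: boundary_ok_def active_def edge_chain_append pre_digraph.cas.simps)
qed

end

theory Submission
  imports Defs
begin

text \<open>
  Fix a time \<open>T\<close>. The vertices on the upper boundary of the explored map that can be reached by
  directed paths from the vertices born before \<open>T\<close> always form a final segment of this boundary. If
  the segment shrinks to the last vertex \<open>v\<close> of the boundary, then every directed path from an old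
  vertex to a vertex born later passes through \<open>v\<close>, so that the directed distances split at \<open>v\<close> and
  their differences no longer depend on the far endpoint. The position of the segment is a Markov
  chain in the plane driven by the increments of the walk, and it remains to see that it is
  recurrent. This is a critical case, with about \<open>log n\<close> visits up to time \<open>n\<close>. It is handled by
  duality: the expected number of visits is the expected occupation time of a half plane for a dual
  chain stopped on leaving \<open>r \<ge> 0\<close>. That chain has an explicit positive quadratic harmonic function, which
  is incompatible with a finite occupation time.
\<close>

text \<open>Away from \<open>q = 0\<close> the chain of the front has zero drift, for
  \<open>z \<ge> 2\<close> as well as for \<open>z \<le> 1\<close>, so recurrence cannot be read off
  from a drift condition. The dual chain is tractable because \<open>u + r\<close> is a martingale
  that moves only while \<open>u \<ge> 1\<close>: its quadratic variation is 2/3 of the occupation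
  time that has to be infinite. All probabilities are defined by recursion over the three
  increments, so every expectation is a finite average and limits pass through it without
  domination. Uniqueness of the Busemann function rests on a separate fact: any two vertices have
  infinitely many common descendants, since every vertex leads to the east end of the upper boundary
  and this end is extended infinitely often.\<close>

section \<open>Recurrence of the front\<close>

definition avg :: "(int \<times> int \<Rightarrow> real) \<Rightarrow> real" where
  "avg f = (f (1, -1) + f (-1, 0) + f (0, 1)) / 3"

lemma avg_mono: "(\<And>c. f c \<le> g c) \<Longrightarrow> avg f \<le> avg g"
  unfolding avg_def by (simp add: add_mono divide_right_mono)

lemma avg_const [simp]: "avg (\<lambda>_. b) = b"
  by (simp add: avg_def)

text \<open>The probability that the chain with steps \<open>F\<close>, driven by uniform
  increments, avoids \<open>t\<close> at times 0 to \<open>n\<close>. The link to the random walk is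
  \<open>prob_run_avoids_le\<close>.\<close>

primrec survival :: "(int \<times> int \<Rightarrow> 's \<Rightarrow> 's) \<Rightarrow> 's \<Rightarrow> nat \<Rightarrow> 's \<Rightarrow> real" where
  "survival F t 0 x = (if x = t then 0 else 1)"
| "survival F t (Suc n) x = (if x = t then 0 else avg (\<lambda>c. survival F t n (F c x)))"

lemma survival_target [simp]: "survival F t n t = 0"
  by (cases n) auto

lemma survival_bounds: "0 \<le> survival F t n x" "survival F t n x \<le> 1"
proof -
  have "0 \<le> survival F t n x \<and> survival F t n x \<le> 1"
  proof (induction n arbitrary: x)
    case (Suc n)
    have "avg (\<lambda>_. 0) \<le> avg (\<lambda>c. survival F t n (F c x))" "avg (\<lambda>c. survival F t n (F c x)) \<le> avg (\<lambda>_. 1)"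
      by (rule avg_mono, simp only: Suc)+
    then have "0 \<le> avg (\<lambda>c. survival F t n (F c x))" "avg (\<lambda>c. survival F t n (F c x)) \<le> 1"
      by (simp_all only: avg_const)
    then show ?case by simp
  qed auto
  then show "0 \<le> survival F t n x" "survival F t n x \<le> 1" by auto
qed

lemma survival_Suc_le: "survival F t (Suc n) x \<le> survival F t n x"
proof (induction n arbitrary: x)
  case 0
  show ?case using survival_bounds(2)[of F t 1 x] by auto
next
  case (Suc n)
  show ?case
    using avg_mono[of "\<lambda>c. survival F t (Suc n) (F c x)", OF Suc.IH] by auto
qed

text \<open>An average of three nonnegative numbers is at least a third of each. Vanishing survival
  thus passes from a state to its successors.\<close>

lemma survival_step_le: "x \<noteq> t \<Longrightarrow> c \<in> {(1,-1),(-1,0),(0,1)} \<Longrightarrow> survival F t n (F c x) \<le> 3 * survival F t (Suc n) x"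
  using survival_bounds(1)[of F t n] by (auto simp: avg_def)

lemma lazy_walk_absorbed:
  fixes f :: "nat \<Rightarrow> nat \<Rightarrow> real"
  assumes zero: "\<And>n. f n 0 = 0" and bounds: "\<And>n k. 0 \<le> f n k" "\<And>n k. f n k \<le> 1"
    and decr: "\<And>n k. f (Suc n) k \<le> f n k"
    and step: "\<And>n k. f (Suc n) (Suc k) = (f n k + f n (Suc k) + f n (Suc (Suc k))) / 3"
  shows "(\<lambda>n. f n k) \<longlonglongrightarrow> 0"
proof -
  txt \<open>The limit is bounded and harmonic, hence linear in \<open>k\<close>.\<close>
  have "\<exists>l. (\<lambda>n. f n k) \<longlonglongrightarrow> l" for k
  proof -
    have "decseq (\<lambda>n. f n k)" by (rule decseq_SucI) (rule decr)
    then obtain l where "(\<lambda>n. f n k) \<longlonglongrightarrow> l"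
      by (rule decseq_convergent) (rule allI, rule bounds(1))
    then show ?thesis ..
  qed
  then obtain l where l: "\<And>k. (\<lambda>n. f n k) \<longlonglongrightarrow> l k" by metis
  have l0: "l 0 = 0" using l[of 0] by (simp add: zero LIMSEQ_const_iff)
  have rec: "l (Suc (Suc k)) = 2 * l (Suc k) - l k" for k
  proof -
    have "(\<lambda>n. f (Suc n) (Suc k)) \<longlonglongrightarrow> (l k + l (Suc k) + l (Suc (Suc k))) / 3"
      unfolding step by (intro tendsto_divide tendsto_add tendsto_const l) simp
    moreover have "(\<lambda>n. f (Suc n) (Suc k)) \<longlonglongrightarrow> l (Suc k)" by (rule LIMSEQ_Suc[OF l])
    ultimately have "(l k + l (Suc k) + l (Suc (Suc k))) / 3 = l (Suc k)" by (rule LIMSEQ_unique)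
    then show ?thesis by simp
  qed
  have lin: "l k = real k * l 1 \<and> l (Suc k) = real (Suc k) * l 1" for k
  proof (induction k)
    case (Suc k)
    then have "l (Suc (Suc k)) = 2 * (real (Suc k) * l 1) - real k * l 1" by (simp only: rec)
    then show ?case using Suc by (simp add: algebra_simps)
  qed (simp add: l0)
  have bd: "0 \<le> l k" "l k \<le> 1" for k
    using l[of k] bounds by (auto intro: LIMSEQ_le_const LIMSEQ_le_const2)
  have "l 1 = 0"
  proof (rule ccontr)
    assume "l 1 \<noteq> 0"
    then have "l 1 > 0" using bd(1)[of 1] by simp
    then obtain k where "real k * l 1 > 1" using reals_Archimedean3 by blast
    with lin[of k] bd(2)[of k] show False by simp
  qed
  with lin[of k] l[of k] show ?thesis by simp
qed

text \<open>\<open>k\<close> is one more than the number of missing edges on the upper right, so a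
  hit of 0 is a step \<open>(1, -1)\<close> that finds none and extends the map to the east. The
  same lazy walk drives the dual coordinate \<open>r\<close>, with \<open>k = r + 1\<close>.\<close>

definition east_step :: "int \<times> int \<Rightarrow> nat \<Rightarrow> nat" where
  "east_step c k = (if c = (1,-1) then k - 1 else if c = (-1,0) then k else k + 1)"

text \<open>\<open>k\<close> is the length of the upper-left boundary; 0 stands for a step
  \<open>(-1, 0)\<close> taken when only the active edge is left, which extends the map to the
  west.\<close>

definition west_step :: "int \<times> int \<Rightarrow> nat \<Rightarrow> nat" where
  "west_step c k = (if c = (1,-1) then k + 1 else if c = (-1,0) then k - 1 else k)"

lemma survival_east: "(\<lambda>n. survival east_step 0 n k) \<longlonglongrightarrow> 0"
proof (rule lazy_walk_absorbed)
  show "survival east_step 0 (Suc n) (Suc k) =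
      (survival east_step 0 n k + survival east_step 0 n (Suc k) + survival east_step 0 n (Suc (Suc k))) / 3" for n k
    by (simp add: avg_def east_step_def)
qed (simp_all only: survival_target survival_bounds survival_Suc_le)

lemma survival_west: "(\<lambda>n. survival west_step 0 n k) \<longlonglongrightarrow> 0"
proof (rule lazy_walk_absorbed)
  show "survival west_step 0 (Suc n) (Suc k) =
      (survival west_step 0 n k + survival west_step 0 n (Suc k) + survival west_step 0 n (Suc (Suc k))) / 3" for n k
    by (simp add: avg_def west_step_def)
qed (simp_all only: survival_target survival_bounds survival_Suc_le)

section \<open>The chain of the front and its dual\<close>

text \<open>
  Mark the vertices on the upper boundary that can be reached from a given set of old vertices. They
  are the last \<open>z + q\<close> vertices, where \<open>q\<close> is the number of vertices following the active edge;
  \<open>(1, 0)\<close> means that the very last vertex is the only one.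
\<close>

definition front_step :: "int \<times> int \<Rightarrow> int \<times> nat \<Rightarrow> int \<times> nat" where
  "front_step c x = (case x of (z, q) \<Rightarrow>
     if c = (1,-1) then (z + 1, q - 1)
     else if c = (-1,0) then (if z \<ge> 2 then z - 1 else z, q)
     else (if z \<ge> 2 then z else z - 1, q + 1))"

primrec occupation :: "(int \<times> nat) set \<Rightarrow> nat \<Rightarrow> int \<times> nat \<Rightarrow> real" where
  "occupation B 0 x = of_bool (x \<in> B)"
| "occupation B (Suc n) x = avg (\<lambda>c. occupation B n (front_step c x))"

text \<open>
  The preimages of \<open>dual_set d\<close> under the three steps are again of this form (empty if
  \<open>snd d < 0\<close>), which gives a dual chain on the parameters \<open>(u, r)\<close>, stopped when \<open>r < 0\<close>.
\<close>

definition dual_set :: "int \<times> int \<Rightarrow> (int \<times> nat) set" where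
  "dual_set d = {(z, q). int q \<le> snd d \<and> z \<le> fst d}"

definition dual_op :: "(int \<times> int \<Rightarrow> real) \<Rightarrow> int \<times> int \<Rightarrow> real" where
  "dual_op f d = (case d of (u, r) \<Rightarrow>
     if r < 0 then f (u, r)
     else if u \<ge> 1 then (f (u - 1, r + 1) + f (u + 1, r) + f (u, r - 1)) / 3
     else (f (u - 1, r + 1) + f (u, r) + f (u + 1, r - 1)) / 3)"

lemma dual_op_indicator: "avg (\<lambda>c. of_bool (front_step c x \<in> dual_set d)) = dual_op (\<lambda>d. of_bool (x \<in> dual_set d)) d"
  by (cases x; cases d) (auto simp: avg_def dual_op_def dual_set_def front_step_def of_bool_def)

text \<open>The forward average acts on the state \<open>x\<close> and \<open>dual_op\<close> on the
  parameter \<open>d\<close>, so the two commute, and the duality of indicators extends to all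
  times.\<close>

lemma occupation_dual: "occupation (dual_set d) (Suc n) x = dual_op (\<lambda>d. occupation (dual_set d) n x) d"
proof (induction n arbitrary: x)
  case 0
  show ?case using dual_op_indicator by simp
next
  case (Suc n)
  have "occupation (dual_set d) (Suc (Suc n)) x = avg (\<lambda>c. occupation (dual_set d) (Suc n) (front_step c x))"
    by simp
  also have "\<dots> = avg (\<lambda>c. dual_op (\<lambda>d. occupation (dual_set d) n (front_step c x)) d)"
    by (simp only: Suc)
  also have "\<dots> = dual_op (\<lambda>d. occupation (dual_set d) (Suc n) x) d"
    by (cases d) (auto simp: dual_op_def avg_def field_simps)
  finally show ?case .
qed

text \<open>This is membership of \<open>(1, 0)\<close> in \<open>dual_set d\<close>, read as a
  function of the dual state.\<close>

definition dual_on :: "int \<times> int \<Rightarrow> real" where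
  "dual_on d = of_bool (0 \<le> snd d \<and> 1 \<le> fst d)"

lemma occupation_origin: "occupation (dual_set d) n (1, 0) = (dual_op ^^ n) dual_on d"
proof (induction n arbitrary: d)
  case 0
  show ?case by (cases d) (auto simp: dual_on_def dual_set_def)
next
  case (Suc n)
  show ?case by (subst occupation_dual) (simp add: Suc)
qed

section \<open>Martingale and harmonic function of the dual chain\<close>

definition dual_height :: "int \<times> int \<Rightarrow> real" where
  "dual_height d = of_int (fst d + snd d)"

definition dual_alive :: "int \<times> int \<Rightarrow> real" where
  "dual_alive d = of_bool (0 \<le> snd d)"

text \<open>
  In the half plane \<open>u \<ge> 1\<close> this is the quadratic harmonic function vanishing at \<open>r = -1\<close>; for
  \<open>u \<le> 0\<close> the dual chain only moves along the level lines of \<open>u + r\<close>.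
\<close>

definition dual_harm :: "int \<times> int \<Rightarrow> real" where
  "dual_harm d = (case d of (u, r) \<Rightarrow>
     if u \<ge> 1 then (of_int r + 1) * (of_int r + 2 * of_int u)
     else (of_int r + of_int u) * (of_int r + of_int u + 1))"

text \<open>The dual chain started at \<open>(1, 0)\<close> never leaves this region. In it the
  chain stops only at points with \<open>r = -1\<close> and \<open>u \<ge> 1\<close>, where
  \<open>dual_harm\<close> vanishes, and has \<open>u + r \<ge> 1\<close> before that.\<close>

definition dual_dom :: "(int \<times> int) set" where
  "dual_dom = {(u, r). r \<ge> 0 \<and> u + r \<ge> 1 \<or> r = -1 \<and> u \<ge> 1}"

lemma dual_op_mono_on:
  assumes "\<And>d. d \<in> dual_dom \<Longrightarrow> f d \<le> g d" "d \<in> dual_dom"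
  shows "dual_op f d \<le> dual_op g d"
  using assms(2) unfolding dual_op_def
  by (cases d) (auto simp: dual_dom_def intro!: divide_right_mono add_mono assms(1))

lemma dual_op_power_mono_on:
  assumes "\<And>d. d \<in> dual_dom \<Longrightarrow> f d \<le> g d" "d \<in> dual_dom"
  shows "(dual_op ^^ n) f d \<le> (dual_op ^^ n) g d"
  using assms(2)
proof (induction n arbitrary: d)
  case (Suc n)
  then show ?case by (simp add: dual_op_mono_on)
qed (simp add: assms)

lemma dual_op_mono: "(\<And>d. f d \<le> g d) \<Longrightarrow> dual_op f d \<le> dual_op g d"
  unfolding dual_op_def by (cases d) (auto intro!: divide_right_mono add_mono)

lemma dual_op_power_mono: "(\<And>d. f d \<le> g d) \<Longrightarrow> (dual_op ^^ n) f d \<le> (dual_op ^^ n) g d"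
  by (induction n arbitrary: d) (simp_all add: dual_op_mono)

lemma dual_op_linear: "dual_op (\<lambda>d. a * f d + b * g d) d = a * dual_op f d + b * dual_op g d"
  by (cases d) (auto simp: dual_op_def field_simps)

lemma dual_op_power_linear:
  "(dual_op ^^ n) (\<lambda>d. a * f d + b * g d) d = a * (dual_op ^^ n) f d + b * (dual_op ^^ n) g d"
proof (induction n arbitrary: d)
  case (Suc n)
  then show ?case using dual_op_linear[of a "(dual_op ^^ n) f" b "(dual_op ^^ n) g" d]
    by (simp add: ext[OF Suc])
qed simp

lemma dual_op_power_sum:
  "finite I \<Longrightarrow> (dual_op ^^ n) (\<lambda>d. \<Sum>i\<in>I. f i d) d = (\<Sum>i\<in>I. (dual_op ^^ n) (f i) d)"
proof (induction I arbitrary: d rule: finite_induct)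
  case empty
  show ?case using dual_op_power_linear[of n 0 "\<lambda>_. 0" 0 "\<lambda>_. 0" d] by simp
next
  case (insert i I)
  then show ?case using dual_op_power_linear[of n 1 "f i" 1 "\<lambda>d. \<Sum>i\<in>I. f i d" d] by simp
qed

text \<open>\<open>dual_op\<close> evaluates its argument at no more than three points, so pointwise
  convergence suffices.\<close>

lemma dual_op_tendsto_0:
  assumes "\<And>d. (\<lambda>n. f n d) \<longlonglongrightarrow> 0"
  shows "(\<lambda>n. dual_op (f n) d) \<longlonglongrightarrow> 0"
proof -
  obtain u r where d: "d = (u, r)" by (cases d)
  have s: "(\<lambda>n. (f n a + f n b + f n c) / 3) \<longlonglongrightarrow> 0" for a b c
  proof -
    have "(\<lambda>n. (f n a + f n b + f n c) / 3) \<longlonglongrightarrow> (0 + 0 + 0) / 3"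
      by (intro tendsto_divide tendsto_add tendsto_const assms) simp
    then show ?thesis by simp
  qed
  consider "r < 0" | "r \<ge> 0" "u \<ge> 1" | "r \<ge> 0" "u < 1" by linarith
  then show ?thesis by cases (simp_all add: dual_op_def d assms s)
qed

lemma dual_op_power_tendsto_0:
  assumes "\<And>d. (\<lambda>n. f n d) \<longlonglongrightarrow> 0"
  shows "(\<lambda>n. (dual_op ^^ m) (f n) d) \<longlonglongrightarrow> 0"
  by (induction m arbitrary: d) (simp_all add: assms dual_op_tendsto_0)

text \<open>The two formulas in \<open>dual_harm\<close> differ by \<open>u * (1 - u)\<close>. They
  agree at \<open>u = 0\<close> and \<open>u = 1\<close>, so one polynomial serves all neighbours of
  a given point.\<close>

lemma dual_harm_fixed: "dual_op dual_harm = dual_harm"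
proof
  fix d :: "int \<times> int"
  obtain u r where d: "d = (u, r)" by (cases d)
  consider "r < 0" | "r \<ge> 0" "u \<ge> 2" | "r \<ge> 0" "u = 1" | "r \<ge> 0" "u = 0" | "r \<ge> 0" "u < 0" by linarith
  then show "dual_op dual_harm d = dual_harm d"
    by cases (auto simp: d dual_op_def dual_harm_def field_simps)
qed

lemma dual_harm_power: "(dual_op ^^ n) dual_harm = dual_harm"
  by (induction n) (simp_all add: dual_harm_fixed)

text \<open>While \<open>dual_on\<close> holds, \<open>dual_height\<close> moves by 0, 1 or -1 with
  equal probability, otherwise it stands still. The constant 2/3 is the variance of such a
  move.\<close>

lemma dual_square:
  "(dual_op ^^ n) (\<lambda>d. (dual_height d - c)\<^sup>2) d = (dual_height d - c)\<^sup>2 + 2 / 3 * (\<Sum>j<n. (dual_op ^^ j) dual_on d)"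
proof (induction n arbitrary: d)
  case (Suc n)
  have 1: "dual_op (\<lambda>d. (dual_height d - c)\<^sup>2) = (\<lambda>d. 1 * (dual_height d - c)\<^sup>2 + 2 / 3 * dual_on d)"
  proof
    fix d :: "int \<times> int"
    obtain u r where d: "d = (u, r)" by (cases d)
    consider "r < 0" | "r \<ge> 0" "u \<ge> 1" | "r \<ge> 0" "u < 1" by linarith
    then show "dual_op (\<lambda>d. (dual_height d - c)\<^sup>2) d = 1 * (dual_height d - c)\<^sup>2 + 2 / 3 * dual_on d"
      by cases (auto simp: d dual_op_def dual_height_def dual_on_def power2_eq_square field_simps)
  qed
  have "(dual_op ^^ Suc n) (\<lambda>d. (dual_height d - c)\<^sup>2) d = (dual_op ^^ n) (dual_op (\<lambda>d. (dual_height d - c)\<^sup>2)) d"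
    by (simp add: funpow_swap1)
  also have "\<dots> = (dual_op ^^ n) (\<lambda>d. 1 * (dual_height d - c)\<^sup>2 + 2 / 3 * dual_on d) d"
    by (simp only: 1)
  also have "\<dots> = (dual_op ^^ n) (\<lambda>d. (dual_height d - c)\<^sup>2) d + 2 / 3 * (dual_op ^^ n) dual_on d"
    by (subst dual_op_power_linear) simp
  finally show ?case by (simp add: Suc algebra_simps)
qed simp

text \<open>In both branches of \<open>dual_op\<close> the coordinate \<open>r\<close> moves by 1, 0
  or -1 with equal probability, whatever \<open>u\<close> is. Stopping at \<open>r = -1\<close>
  becomes absorption of the lazy walk at 0.\<close>

lemma dual_alive_tendsto_0: "(\<lambda>n. (dual_op ^^ n) dual_alive (u, r)) \<longlonglongrightarrow> 0"
proof -
  have eq: "(dual_op ^^ n) dual_alive (u, int k - 1) = survival east_step 0 n k" for n u k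
  proof (induction n arbitrary: u k)
    case 0
    show ?case by (simp add: dual_alive_def)
  next
    case (Suc n)
    show ?case
    proof (cases k)
      case 0
      with Suc[of u 0] show ?thesis by (simp add: dual_op_def)
    next
      case (Suc l)
      with Suc.IH[of _ l] Suc.IH[of _ "Suc l"] Suc.IH[of _ "Suc (Suc l)"] show ?thesis
        by (simp add: dual_op_def avg_def east_step_def algebra_simps)
    qed
  qed
  have neg: "(dual_op ^^ n) dual_alive (u, r) = 0" if "r < 0" for n
    using that by (induction n) (auto simp: dual_op_def dual_alive_def)
  show ?thesis
  proof (cases "r < 0")
    case False
    then have "(dual_op ^^ n) dual_alive (u, r) = survival east_step 0 n (nat (r + 1))" for n
      using eq[of n u "nat (r + 1)"] by simp
    then show ?thesis using survival_east by simp
  qed (simp add: neg)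
qed

lemma dual_on_power_nonneg: "0 \<le> (dual_op ^^ n) dual_on d"
proof -
  have "(dual_op ^^ n) (\<lambda>_. 0) d \<le> (dual_op ^^ n) dual_on d"
    by (rule dual_op_power_mono) (simp add: dual_on_def)
  moreover have "(dual_op ^^ n) (\<lambda>_. 0) d = 0"
    using dual_op_power_linear[of n 0 "\<lambda>_. 0" 0 "\<lambda>_. 0" d] by simp
  ultimately show ?thesis by simp
qed

text \<open>
  The expectation of \<open>dual_harm\<close> is constant, which bounds the second moment of \<open>dual_height\<close> on
  survival from below. If the occupation were summable, then \<open>dual_height\<close> would be an
  \<open>L\<^sup>2\<close>-bounded martingale, and this second moment on survival would tend to 0.
\<close>

lemma dual_occupation_not_summable: "\<not> summable (\<lambda>n. (dual_op ^^ n) dual_on (1, 0))"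
proof
  let ?a = "\<lambda>n. (dual_op ^^ n) dual_on (1, 0)"
  let ?k = "\<lambda>d. (dual_height d)\<^sup>2 * dual_alive d"
  assume sm: "summable ?a"
  have low: "1 \<le> (dual_op ^^ n) ?k (1, 0)" for n
  proof -
    \<comment> \<open>Here \<open>dual_harm (1, 0) = 2\<close>, and \<open>dual_harm\<close> is at
      most \<open>2 * ?k\<close> on \<open>dual_dom\<close>. The zero term gives the bound the shape
      of \<open>dual_op_power_linear\<close>.\<close>
    have "(dual_op ^^ n) dual_harm (1, 0) \<le> (dual_op ^^ n) (\<lambda>d. 2 * ?k d + 0 * ?k d) (1, 0)"
    proof (rule dual_op_power_mono_on)
      fix d assume "d \<in> dual_dom"
      then obtain u r where d: "d = (u, r)" "r \<ge> 0 \<and> u + r \<ge> 1 \<or> r = -1 \<and> u \<ge> 1"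
        by (auto simp: dual_dom_def)
      have 1: "(a + 1) * (a + 2 * b) \<le> 2 * (b + a)\<^sup>2" if "a \<ge> 0" "b \<ge> 1" for a b :: real
      proof -
        have "(a + 1) * (a + 2 * b) \<le> (b + a) * (2 * (b + a))" using that by (intro mult_mono) auto
        then show ?thesis by (simp add: power2_eq_square mult_ac)
      qed
      have 2: "b * (b + 1) \<le> 2 * b\<^sup>2" if "b \<ge> 1" for b :: real
      proof -
        have "b * (b + 1) \<le> b * (2 * b)" using that by (intro mult_mono) auto
        then show ?thesis by (simp add: power2_eq_square mult_ac)
      qed
      from 1[of "of_int r" "of_int u"] 2[of "of_int u + of_int r"] d
      show "dual_harm d \<le> 2 * ?k d + 0 * ?k d"
        by (auto simp: dual_harm_def dual_height_def dual_alive_def add.commute)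
    qed (simp add: dual_dom_def)
    then show ?thesis by (subst (asm) dual_op_power_linear) (simp add: dual_harm_power dual_harm_def)
  qed
  \<comment> \<open>Centred at its starting value, \<open>dual_height\<close> has second moment 2/3
    of the occupation; splitting off the centre costs a factor 2, hence 4/3.\<close>
  have up: "(dual_op ^^ n) ?k d \<le> 4 / 3 * (\<Sum>j<n. (dual_op ^^ j) dual_on d)
      + 2 * ((dual_height d)\<^sup>2 * (dual_op ^^ n) dual_alive d)" for n d
  proof -
    let ?c = "dual_height d"
    have "(dual_op ^^ n) ?k d \<le> (dual_op ^^ n) (\<lambda>e. 2 * (dual_height e - ?c)\<^sup>2 + (2 * ?c\<^sup>2) * dual_alive e) d"
    proof (rule dual_op_power_mono)
      fix e
      have "(dual_height e)\<^sup>2 \<le> 2 * (dual_height e - ?c)\<^sup>2 + 2 * ?c\<^sup>2"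
        using zero_le_power2[of "dual_height e - 2 * ?c"] by (simp add: power2_eq_square algebra_simps)
      then show "?k e \<le> 2 * (dual_height e - ?c)\<^sup>2 + (2 * ?c\<^sup>2) * dual_alive e"
        by (simp add: dual_alive_def)
    qed
    then show ?thesis
      by (subst (asm) dual_op_power_linear) (simp add: dual_square)
  qed
  \<comment> \<open>The bound \<open>up\<close> is applied from time \<open>t\<close> on. Its last
    term contains the survival probability over \<open>n\<close> further steps and vanishes as
    \<open>n\<close> grows, so the occupation after time \<open>t\<close> is at least 3/4 for every
    \<open>t\<close>.\<close>
  have tail: "1 \<le> 4 / 3 * ((\<Sum>n. ?a n) - (\<Sum>j<t. ?a j))" for t
  proof -
    let ?e = "\<lambda>n. (dual_op ^^ t) (\<lambda>d. (dual_height d)\<^sup>2 * (dual_op ^^ n) dual_alive d) (1, 0)"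
    have step: "1 \<le> 4 / 3 * ((\<Sum>n. ?a n) - (\<Sum>j<t. ?a j)) + 2 * ?e n" for n
    proof -
      have "1 \<le> (dual_op ^^ t) ((dual_op ^^ n) ?k) (1, 0)"
        using low[of "t + n"] by (simp add: funpow_add)
      also have "\<dots> \<le> (dual_op ^^ t) (\<lambda>d. 4 / 3 * (\<Sum>j<n. (dual_op ^^ j) dual_on d)
          + 2 * ((dual_height d)\<^sup>2 * (dual_op ^^ n) dual_alive d)) (1, 0)"
        by (rule dual_op_power_mono) (rule up)
      also have "\<dots> = 4 / 3 * (\<Sum>j<n. (dual_op ^^ t) ((dual_op ^^ j) dual_on) (1, 0)) + 2 * ?e n"
        by (subst dual_op_power_linear) (simp add: dual_op_power_sum)
      also have "(\<Sum>j<n. (dual_op ^^ t) ((dual_op ^^ j) dual_on) (1, 0)) = (\<Sum>j<n. ?a (t + j))"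
        by (simp add: funpow_add)
      also have "\<dots> = (\<Sum>j<t + n. ?a j) - (\<Sum>j<t. ?a j)"
        by (induction n) auto
      also have "(\<Sum>j<t + n. ?a j) \<le> (\<Sum>n. ?a n)"
        by (rule sum_le_suminf[OF sm]) (auto simp: dual_on_power_nonneg)
      finally show ?thesis by simp
    qed
    have "?e \<longlonglongrightarrow> 0"
    proof (rule dual_op_power_tendsto_0)
      fix d :: "int \<times> int"
      show "(\<lambda>n. (dual_height d)\<^sup>2 * (dual_op ^^ n) dual_alive d) \<longlonglongrightarrow> 0"
        using tendsto_mult_left[OF dual_alive_tendsto_0[of "fst d" "snd d"], of "(dual_height d)\<^sup>2"] by simp
    qed
    then have "(\<lambda>n. 4 / 3 * ((\<Sum>n. ?a n) - (\<Sum>j<t. ?a j)) + 2 * ?e n) \<longlonglongrightarrow> 4 / 3 * ((\<Sum>n. ?a n) - (\<Sum>j<t. ?a j)) + 2 * 0"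
      by (intro tendsto_intros)
    from LIMSEQ_le_const[OF this, of 1] step show ?thesis by simp
  qed
  have "(\<lambda>t. 4 / 3 * ((\<Sum>n. ?a n) - (\<Sum>j<t. ?a j))) \<longlonglongrightarrow> 4 / 3 * ((\<Sum>n. ?a n) - (\<Sum>n. ?a n))"
    by (intro tendsto_intros summable_LIMSEQ sm)
  from LIMSEQ_le_const[OF this, of 1] tail have "(1::real) \<le> 4 / 3 * ((\<Sum>n. ?a n) - (\<Sum>n. ?a n))"
    by blast
  then show False by simp
qed

section \<open>Last exit decomposition and recurrence\<close>

definition no_return :: "nat \<Rightarrow> real" where
  "no_return n = (case n of 0 \<Rightarrow> 1 | Suc m \<Rightarrow> avg (\<lambda>c. survival front_step (1, 0) m (front_step c (1, 0))))"

lemma avg_sum: "finite I \<Longrightarrow> avg (\<lambda>c. \<Sum>i\<in>I. f i c) = (\<Sum>i\<in>I. avg (f i))"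
  by (simp add: avg_def sum.distrib sum_divide_distrib add_divide_distrib)

text \<open>Decomposition at the last visit to \<open>(1, 0)\<close> up to time \<open>n\<close>;
  the survival term is the case of no visit. \<open>no_return m\<close> is the probability that the
  chain started at \<open>(1, 0)\<close> stays away from it at times 1 to \<open>m\<close>.\<close>

lemma last_exit:
  "(\<Sum>j\<le>n. occupation {(1, 0)} j x * no_return (n - j)) + survival front_step (1, 0) n x = 1"
proof (induction n arbitrary: x)
  case 0
  show ?case by (simp add: no_return_def)
next
  case (Suc n)
  let ?s = "\<lambda>n. survival front_step (1, 0) n"
  have "(\<Sum>j\<le>Suc n. occupation {(1, 0)} j x * no_return (Suc n - j))
      = occupation {(1, 0)} 0 x * no_return (Suc n)
        + (\<Sum>j\<le>n. occupation {(1, 0)} (Suc j) x * no_return (n - j))"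
    by (subst sum.atMost_Suc_shift) simp
  also have "(\<Sum>j\<le>n. occupation {(1, 0)} (Suc j) x * no_return (n - j))
      = avg (\<lambda>c. \<Sum>j\<le>n. occupation {(1, 0)} j (front_step c x) * no_return (n - j))"
    by (subst avg_sum) (auto simp: avg_def algebra_simps add_divide_distrib)
  also have "\<dots> = avg (\<lambda>c. 1 - ?s n (front_step c x))"
    using Suc by (intro arg_cong[of _ _ avg] ext) (simp add: algebra_simps)
  also have "\<dots> = 1 - avg (\<lambda>c. ?s n (front_step c x))"
    by (simp add: avg_def field_simps)
  finally show ?case by (auto simp: no_return_def)
qed

lemma no_return_nonneg: "0 \<le> no_return n"
proof (cases n)
  case (Suc m)
  have "avg (\<lambda>_. 0) \<le> avg (\<lambda>c. survival front_step (1, 0) m (front_step c (1, 0)))"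
    by (intro avg_mono survival_bounds)
  with Suc show ?thesis by (simp add: no_return_def)
qed (simp add: no_return_def)

lemma no_return_antimono: "m \<le> n \<Longrightarrow> no_return n \<le> no_return m"
proof (rule lift_Suc_antimono_le[of no_return])
  fix n
  show "no_return (Suc n) \<le> no_return n"
  proof (cases n)
    case 0
    have "avg (\<lambda>c. survival front_step (1, 0) 0 (front_step c (1, 0))) \<le> avg (\<lambda>_. 1)"
      by (intro avg_mono survival_bounds)
    with 0 show ?thesis by (simp add: no_return_def del: survival.simps)
  next
    case (Suc m)
    then show ?thesis by (simp add: no_return_def avg_mono survival_Suc_le del: survival.simps)
  qed
qed

text \<open>By \<open>last_exit\<close> and monotonicity, \<open>no_return n\<close> times the
  expected number of visits up to time \<open>n\<close> is at most 1, and this number diverges by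
  duality.\<close>

lemma no_return_tendsto_0: "no_return \<longlonglongrightarrow> 0"
proof -
  let ?a = "\<lambda>n. (dual_op ^^ n) dual_on (1, 0)"
  let ?U = "\<lambda>n. \<Sum>j\<le>n. ?a j"
  have sg: "occupation {(1, 0)} n (1, 0) = ?a n" for n
  proof -
    \<comment> \<open>The chain preserves \<open>z + q \<ge> 1\<close>, and under this constraint
      \<open>(1, 0)\<close> is the only point of \<open>dual_set (1, 0)\<close>.\<close>
    have "occupation {(1, 0)} n y = occupation (dual_set (1, 0)) n y" if "fst y + int (snd y) \<ge> 1" for y
      using that
    proof (induction n arbitrary: y)
      case 0
      then show ?case by (cases y) (auto simp: dual_set_def)
    next
      case (Suc n)
      have "fst (front_step c y) + int (snd (front_step c y)) \<ge> 1" for c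
        using Suc.prems by (cases y) (auto simp: front_step_def)
      then show ?case by (simp add: Suc.IH)
    qed
    from this[of "(1, 0)"] show ?thesis by (simp add: occupation_origin)
  qed
  have bound: "no_return n * ?U n \<le> 1" for n
  proof -
    have "no_return n * ?U n = (\<Sum>j\<le>n. ?a j * no_return n)" by (simp add: sum_distrib_left mult.commute)
    also have "\<dots> \<le> (\<Sum>j\<le>n. ?a j * no_return (n - j))"
      by (intro sum_mono mult_left_mono no_return_antimono dual_on_power_nonneg) auto
    also have "\<dots> \<le> 1" using last_exit[of "(1, 0)" n] by (simp add: sg)
    finally show ?thesis .
  qed
  have U: "filterlim ?U at_top at_top"
  proof (rule ccontr)
    have inc: "mono ?U" by (auto intro!: monoI sum_mono2 dual_on_power_nonneg)
    assume "\<not> ?thesis"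
    then obtain Z where Z: "\<not> eventually (\<lambda>n. Z \<le> ?U n) sequentially"
      by (auto simp: filterlim_at_top)
    have "?U n \<le> Z" for n
    proof (rule ccontr)
      assume "\<not> ?U n \<le> Z"
      then have "\<forall>m\<ge>n. Z \<le> ?U m" using inc by (smt (verit) monoD)
      with Z show False by (auto simp: eventually_sequentially)
    qed
    moreover have "sum ?a {..<n} \<le> ?U n" for n
      by (intro sum_mono2) (auto simp: dual_on_power_nonneg)
    ultimately have "sum ?a {..<n} \<le> Z" for n by (meson order_trans)
    then have "summable ?a"
      by (intro summableI_nonneg_bounded[where x = Z]) (auto simp: dual_on_power_nonneg)
    with dual_occupation_not_summable show False by simp
  qed
  have "(\<lambda>n. inverse (?U n)) \<longlonglongrightarrow> 0"
    by (rule tendsto_inverse_0_at_top[OF U])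
  moreover have "eventually (\<lambda>n. norm (no_return n) \<le> inverse (?U n)) sequentially"
  proof -
    have "eventually (\<lambda>n. ?U n > 0) sequentially" using U by (simp add: filterlim_at_top_dense)
    then show ?thesis
    proof eventually_elim
      case (elim n)
      with bound[of n] no_return_nonneg[of n] show ?case by (simp add: field_simps)
    qed
  qed
  ultimately show ?thesis by (rule Lim_null_comparison[rotated])
qed

text \<open>The starting points with vanishing survival are closed under steps and include
  \<open>(1, 0)\<close>. From there all states with \<open>z + q \<ge> 1\<close> can be reached:
  east along \<open>q = 0\<close>, up, back to \<open>z = 1\<close>, then along lines of constant
  \<open>z + q\<close>.\<close>

lemma survival_front:
  assumes "z + int q \<ge> 1"
  shows "(\<lambda>n. survival front_step (1, 0) n (z, q)) \<longlonglongrightarrow> 0"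
proof -
  define good where "good x \<longleftrightarrow> (\<lambda>n. survival front_step (1, 0) n x) \<longlonglongrightarrow> 0" for x
  have step: "good (front_step c x)" if "good x" "c \<in> {(1,-1),(-1,0),(0,1)}" for x c
  proof (cases "x = (1, 0)")
    case True
    have "norm (survival front_step (1, 0) n (front_step c x)) \<le> 3 * no_return (Suc n)" for n
      using that(2) survival_bounds(1)[of front_step "(1,0)" n "front_step (1,-1) (1,0)"]
        survival_bounds(1)[of front_step "(1,0)" n "front_step (-1,0) (1,0)"]
        survival_bounds(1)[of front_step "(1,0)" n "front_step (0,1) (1,0)"]
      by (auto simp: no_return_def avg_def True)
    moreover have "(\<lambda>n. 3 * no_return (Suc n)) \<longlonglongrightarrow> 0"
      using tendsto_mult_left[OF LIMSEQ_Suc[OF no_return_tendsto_0], of 3] by simp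
    ultimately show ?thesis unfolding good_def
      by (rule Lim_null_comparison[OF always_eventually, OF allI])
  next
    case False
    have "norm (survival front_step (1, 0) n (front_step c x)) \<le> 3 * survival front_step (1, 0) (Suc n) x" for n
      using survival_step_le[OF False that(2), of front_step n] survival_bounds(1)[of front_step "(1,0)" n "front_step c x"]
      by (simp del: survival.simps)
    moreover have "(\<lambda>n. 3 * survival front_step (1, 0) (Suc n) x) \<longlonglongrightarrow> 0"
      using tendsto_mult_left[OF LIMSEQ_Suc[OF that(1)[unfolded good_def]], of 3] by simp
    ultimately show ?thesis unfolding good_def
      by (rule Lim_null_comparison[OF always_eventually, OF allI])
  qed
  have o: "good (1, 0)" by (simp add: good_def)
  have E: "good (1 + int m, 0)" for m
  proof (induction m)
    case (Suc m)
    from step[OF this, of "(1,-1)"] show ?case by (simp add: front_step_def algebra_simps)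
  qed (simp add: o)
  have R: "good (2 + int m, q)" for m q
  proof (induction q)
    case 0
    from E[of "Suc m"] show ?case by (simp add: algebra_simps)
  next
    case (Suc q)
    from step[OF this, of "(0,1)"] show ?case by (simp add: front_step_def)
  qed
  have L: "good (1, q)" for q
    using step[OF R[of 0 q], of "(-1,0)"] by (simp add: front_step_def)
  have D: "good (1 - int m, q + m)" for m q
  proof (induction m)
    case (Suc m)
    from step[OF this, of "(0,1)"] show ?case by (simp add: front_step_def algebra_simps)
  qed (simp add: L)
  have "good (z, q)"
  proof (cases "z \<ge> 2")
    case True
    with R[of "nat (z - 2)" q] show ?thesis by simp
  next
    case False
    with D[of "nat (1 - z)" "q - nat (1 - z)"] assms show ?thesis by simp
  qed
  then show ?thesis by (simp add: good_def)
qed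

section \<open>Busemann functions from cut vertices\<close>

definition path_lengths :: "('v, 'e) pre_digraph \<Rightarrow> 'v \<Rightarrow> 'v \<Rightarrow> nat set" where
  "path_lengths G u v = length ` {p. directed_path G u p v}"

lemma LDP_Max:
  assumes "finite (path_lengths G u v)" "path_lengths G u v \<noteq> {}"
  shows "LDP G u v = ereal (real (Max (path_lengths G u v)))"
proof -
  have "LDP G u v = (SUP n \<in> path_lengths G u v. ereal (real n))"
    by (simp add: LDP_def path_lengths_def image_image)
  also have "\<dots> = ereal (real (Max (path_lengths G u v)))"
    using assms by (intro antisym SUP_least SUP_upper2[where i = "Max (path_lengths G u v)"]) auto
  finally show ?thesis .
qed

lemma SDP_Min:
  assumes "finite (path_lengths G u v)" "path_lengths G u v \<noteq> {}"
  shows "SDP G u v = ereal (real (Min (path_lengths G u v)))"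
proof -
  have "SDP G u v = (INF n \<in> path_lengths G u v. ereal (real n))"
    by (simp add: SDP_def path_lengths_def image_image)
  also have "\<dots> = ereal (real (Min (path_lengths G u v)))"
    using assms by (intro antisym INF_greatest INF_lower2[where i = "Min (path_lengths G u v)"]) auto
  finally show ?thesis .
qed

lemma directed_path_append:
  "directed_path G u (p @ q) v \<longleftrightarrow> (\<exists>w. directed_path G u p w \<and> pre_digraph.cas G w q v \<and> set q \<subseteq> arcs G)"
proof -
  have "pre_digraph.cas G u (p @ q) v \<longleftrightarrow> (\<exists>w. pre_digraph.cas G u p w \<and> pre_digraph.cas G w q v)"
    by (induction p arbitrary: u) (auto simp: pre_digraph.cas.simps)
  then show ?thesis by (auto simp: directed_path_def pre_digraph.awalk_def)
qed

lemma directed_path_appendI: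
  "directed_path G u p v \<Longrightarrow> directed_path G v q w \<Longrightarrow> directed_path G u (p @ q) w"
  by (auto simp: directed_path_append) (auto simp: directed_path_def pre_digraph.awalk_def)

lemma directed_path_Nil [simp]: "directed_path G u [] v \<longleftrightarrow> u \<in> verts G \<and> u = v"
  by (auto simp: directed_path_def pre_digraph.awalk_def pre_digraph.cas.simps)

lemma directed_path_verts:
  assumes "wf_digraph G" "directed_path G u p v"
  shows "u \<in> verts G" "v \<in> verts G"
  using assms(2) wf_digraph.awalk_hd_in_verts[OF assms(1)] wf_digraph.awalk_last_in_verts[OF assms(1)]
  by (auto simp: directed_path_def)

lemma Max_sumset:
  fixes A B :: "nat set"
  assumes "finite A" "A \<noteq> {}" "finite B" "B \<noteq> {}"
  shows "Max {a + b |a b. a \<in> A \<and> b \<in> B} = Max A + Max B"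
proof (rule Max_eqI)
  have "{a + b |a b. a \<in> A \<and> b \<in> B} = (\<lambda>(a, b). a + b) ` (A \<times> B)" by auto
  then show "finite {a + b |a b. a \<in> A \<and> b \<in> B}" using assms by simp
next
  fix n assume "n \<in> {a + b |a b. a \<in> A \<and> b \<in> B}"
  then obtain a b where "n = a + b" "a \<in> A" "b \<in> B" by blast
  then show "n \<le> Max A + Max B" using assms by (simp add: add_mono)
next
  show "Max A + Max B \<in> {a + b |a b. a \<in> A \<and> b \<in> B}"
    using Max_in[OF assms(1,2)] Max_in[OF assms(3,4)] by blast
qed

lemma Min_sumset:
  fixes A B :: "nat set"
  assumes "finite A" "A \<noteq> {}" "finite B" "B \<noteq> {}"
  shows "Min {a + b |a b. a \<in> A \<and> b \<in> B} = Min A + Min B"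
proof (rule Min_eqI)
  have "{a + b |a b. a \<in> A \<and> b \<in> B} = (\<lambda>(a, b). a + b) ` (A \<times> B)" by auto
  then show "finite {a + b |a b. a \<in> A \<and> b \<in> B}" using assms by simp
next
  fix n assume "n \<in> {a + b |a b. a \<in> A \<and> b \<in> B}"
  then obtain a b where "n = a + b" "a \<in> A" "b \<in> B" by blast
  then show "n \<ge> Min A + Min B" using assms by (simp add: add_mono)
next
  show "Min A + Min B \<in> {a + b |a b. a \<in> A \<and> b \<in> B}"
    using Min_in[OF assms(1,2)] Min_in[OF assms(3,4)] by blast
qed

text \<open>If all paths from \<open>u\<close> to \<open>w\<close> pass through \<open>v\<close>,
  their lengths form a sumset, and the optimum is a sum whose second term does not depend on
  \<open>u\<close>. Differences are therefore constant far away, and common descendants identify the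
  constant.\<close>

lemma Busemann_function_unique_exists:
  fixes G :: "('v, 'e) pre_digraph" and x :: "int \<Rightarrow> 'v" and XDP
  assumes XDP: "XDP \<in> {LDP, SDP}"
    and wf: "wf_digraph G"
    and bounded: "\<And>u v. finite (path_lengths G u v)"
    and x: "\<And>k. x k \<in> verts G"
    and cut: "\<And>F. finite F \<Longrightarrow> F \<subseteq> verts G \<Longrightarrow> \<exists>v C. finite C \<and>
      (\<forall>u w p. u \<in> F \<longrightarrow> w \<notin> C \<longrightarrow> directed_path G u p w \<longrightarrow>
        (\<exists>p1 p2. p = p1 @ p2 \<and> directed_path G u p1 v \<and> directed_path G v p2 w))"
    and common: "\<And>u v. u \<in> verts G \<Longrightarrow> v \<in> verts G \<Longrightarrow>
      infinite {w. (\<exists>p. directed_path G u p w) \<and> (\<exists>p. directed_path G v p w)}"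
  shows "\<exists>!X :: int \<Rightarrow> int. X 0 = 0 \<and>
         (\<forall>k k'. \<forall>w :: nat \<Rightarrow> 'v.
            inj w \<and> range w \<subseteq> verts G \<and>
            (\<forall>j. (\<exists>p. directed_path G (x k) p (w j)) \<and> (\<exists>p. directed_path G (x k') p (w j))) \<longrightarrow>
            (\<forall>\<^sub>F j in sequentially.
               ereal (real_of_int (X k' - X k)) = XDP G (x k') (w j) - XDP G (x k) (w j)))"
proof -
  let ?reach = "\<lambda>u w. \<exists>p. directed_path G u p w"
  \<comment> \<open>A natural-number version of \<open>XDP\<close>, a maximum or minimum of path
    lengths, which treats both cases at once.\<close>
  obtain d :: "'v \<Rightarrow> 'v \<Rightarrow> nat" where
      d: "\<And>u v. ?reach u v \<Longrightarrow> XDP G u v = ereal (real (d u v))"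
    and split: "\<And>u v w. ?reach u v \<Longrightarrow> ?reach v w \<Longrightarrow>
      (\<And>p. directed_path G u p w \<Longrightarrow> \<exists>p1 p2. p = p1 @ p2 \<and> directed_path G u p1 v \<and> directed_path G v p2 w) \<Longrightarrow>
      d u w = d u v + d v w"
  proof -
    have ne: "path_lengths G u v \<noteq> {}" if "?reach u v" for u v
      using that by (auto simp: path_lengths_def)
    have sumset: "path_lengths G u w = {a + b |a b. a \<in> path_lengths G u v \<and> b \<in> path_lengths G v w}"
      if "\<And>p. directed_path G u p w \<Longrightarrow> \<exists>p1 p2. p = p1 @ p2 \<and> directed_path G u p1 v \<and> directed_path G v p2 w"
      for u v w
    proof (intro set_eqI iffI)
      fix n assume "n \<in> path_lengths G u w"
      then obtain p where "directed_path G u p w" "n = length p" by (auto simp: path_lengths_def)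
      with that[of p] show "n \<in> {a + b |a b. a \<in> path_lengths G u v \<and> b \<in> path_lengths G v w}"
        by (fastforce simp: path_lengths_def)
    next
      fix n assume "n \<in> {a + b |a b. a \<in> path_lengths G u v \<and> b \<in> path_lengths G v w}"
      then obtain p q where "directed_path G u p v" "directed_path G v q w" "n = length p + length q"
        by (auto simp: path_lengths_def)
      then show "n \<in> path_lengths G u w"
        using directed_path_appendI unfolding path_lengths_def by (intro image_eqI[where x = "p @ q"]) fastforce+
    qed
    show ?thesis
    proof (cases "XDP = LDP")
      case True
      show ?thesis
      proof (rule that[of "\<lambda>u v. Max (path_lengths G u v)"])
        fix u v w
        assume r: "?reach u v" "?reach v w"
          and p: "\<And>p. directed_path G u p w \<Longrightarrow> \<exists>p1 p2. p = p1 @ p2 \<and> directed_path G u p1 v \<and> directed_path G v p2 w"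
        show "Max (path_lengths G u w) = Max (path_lengths G u v) + Max (path_lengths G v w)"
          using Max_sumset[OF bounded ne[OF r(1)] bounded ne[OF r(2)]] by (simp add: sumset[OF p])
      qed (use True LDP_Max[OF bounded ne] in auto)
    next
      case False
      with XDP have XDP: "XDP = SDP" by simp
      show ?thesis
      proof (rule that[of "\<lambda>u v. Min (path_lengths G u v)"])
        fix u v w
        assume r: "?reach u v" "?reach v w"
          and p: "\<And>p. directed_path G u p w \<Longrightarrow> \<exists>p1 p2. p = p1 @ p2 \<and> directed_path G u p1 v \<and> directed_path G v p2 w"
        show "Min (path_lengths G u w) = Min (path_lengths G u v) + Min (path_lengths G v w)"
          using Min_sumset[OF bounded ne[OF r(1)] bounded ne[OF r(2)]] by (simp add: sumset[OF p])
      qed (use XDP SDP_Min[OF bounded ne] in auto)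
    qed
  qed
  let ?D = "\<lambda>u v w. int (d v w) - int (d u w)"
  have ev: "\<exists>e C. finite C \<and> (\<forall>a\<in>F. \<forall>b\<in>F. \<forall>w. w \<notin> C \<longrightarrow> ?reach a w \<longrightarrow> ?reach b w \<longrightarrow>
      ?D a b w = e b - e a)" if F: "finite F" "F \<subseteq> verts G" for F
  proof -
    from cut[OF F] obtain v C where "finite C \<and> (\<forall>u w p. u \<in> F \<longrightarrow> w \<notin> C \<longrightarrow> directed_path G u p w \<longrightarrow>
        (\<exists>p1 p2. p = p1 @ p2 \<and> directed_path G u p1 v \<and> directed_path G v p2 w))"
      by (elim exE)
    then have C: "finite C" and c: "\<And>u w p. u \<in> F \<Longrightarrow> w \<notin> C \<Longrightarrow> directed_path G u p w \<Longrightarrow>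
        \<exists>p1 p2. p = p1 @ p2 \<and> directed_path G u p1 v \<and> directed_path G v p2 w"
      by simp_all
    have "d u w = d u v + d v w" if "u \<in> F" "w \<notin> C" and r: "?reach u w" for u w
    proof (rule split)
      show "\<exists>p1 p2. p = p1 @ p2 \<and> directed_path G u p1 v \<and> directed_path G v p2 w"
        if "directed_path G u p w" for p using c[OF \<open>u \<in> F\<close> \<open>w \<notin> C\<close> that] .
      from r obtain p where "directed_path G u p w" ..
      from c[OF \<open>u \<in> F\<close> \<open>w \<notin> C\<close> this] show "?reach u v" "?reach v w" by blast+
    qed
    then have "\<forall>a\<in>F. \<forall>b\<in>F. \<forall>w. w \<notin> C \<longrightarrow> ?reach a w \<longrightarrow> ?reach b w \<longrightarrow> ?D a b w = int (d b v) - int (d a v)"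
      by simp
    with C show ?thesis by (intro exI[of _ "\<lambda>u. int (d u v)"] exI[of _ C]) blast
  qed
  have "\<exists>c. \<exists>C. finite C \<and> (\<forall>w. w \<notin> C \<longrightarrow> ?reach (x 0) w \<longrightarrow> ?reach (x k) w \<longrightarrow> ?D (x 0) (x k) w = c)" for k
    using ev[of "{x 0, x k}"] x by auto
  then obtain X where X: "\<And>k. \<exists>C. finite C \<and>
      (\<forall>w. w \<notin> C \<longrightarrow> ?reach (x 0) w \<longrightarrow> ?reach (x k) w \<longrightarrow> ?D (x 0) (x k) w = X k)" by metis
  have Xdiff: "\<exists>C. finite C \<and> (\<forall>w. w \<notin> C \<longrightarrow> ?reach (x k) w \<longrightarrow> ?reach (x k') w \<longrightarrow> ?D (x k) (x k') w = X k' - X k)"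
    for k k'
  proof -
    \<comment> \<open>A vertex reachable from \<open>x k\<close> and \<open>x k'\<close> need not be
      reachable from \<open>x 0\<close>, so the defining differences of \<open>X\<close> cannot be
      subtracted there. A cut common to all three vertices yields one potential \<open>e\<close>,
      which is compared with \<open>X\<close> at other far vertices.\<close>
    have "finite {x 0, x k, x k'}" "{x 0, x k, x k'} \<subseteq> verts G" using x by auto
    from ev[OF this] obtain e C where "finite C \<and> (\<forall>a\<in>{x 0, x k, x k'}. \<forall>b\<in>{x 0, x k, x k'}. \<forall>w.
        w \<notin> C \<longrightarrow> ?reach a w \<longrightarrow> ?reach b w \<longrightarrow> ?D a b w = e b - e a)"
      by (elim exE)
    then have C: "finite C" and eC: "\<And>a b w. a \<in> {x 0, x k, x k'} \<Longrightarrow> b \<in> {x 0, x k, x k'} \<Longrightarrow> w \<notin> C \<Longrightarrow>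
        ?reach a w \<Longrightarrow> ?reach b w \<Longrightarrow> ?D a b w = e b - e a"
      by blast+
    have Xe: "X l = e (x l) - e (x 0)" if "l \<in> {k, k'}" for l
    proof -
      obtain C' where C': "finite C'"
        "\<And>w. w \<notin> C' \<Longrightarrow> ?reach (x 0) w \<Longrightarrow> ?reach (x l) w \<Longrightarrow> ?D (x 0) (x l) w = X l" using X[of l] by blast
      have "infinite ({w. ?reach (x 0) w \<and> ?reach (x l) w} - (C \<union> C'))"
        using common[OF x x] C C'(1) by (intro Diff_infinite_finite) auto
      then have "{w. ?reach (x 0) w \<and> ?reach (x l) w} - (C \<union> C') \<noteq> {}" by force
      then obtain w where "w \<notin> C" "w \<notin> C'" "?reach (x 0) w" "?reach (x l) w" by blast
      with eC[of "x 0" "x l" w] C'(2)[of w] that show ?thesis by auto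
    qed
    have "?D (x k) (x k') w = X k' - X k" if "w \<notin> C" "?reach (x k) w" "?reach (x k') w" for w
      using eC[of "x k" "x k'" w] that Xe[of k] Xe[of k'] by simp
    with C show ?thesis by blast
  qed
  have X0: "X 0 = 0"
  proof -
    obtain C where C: "finite C" "\<And>w. w \<notin> C \<Longrightarrow> ?reach (x 0) w \<Longrightarrow> X 0 = 0" using X[of 0] by auto
    have "infinite ({w. ?reach (x 0) w} - C)"
      using common[OF x[of 0] x[of 0]] C(1) by (intro Diff_infinite_finite) simp_all
    then have "{w. ?reach (x 0) w} - C \<noteq> {}" by (intro notI) simp
    with C(2) show ?thesis by blast
  qed
  have lim: "\<forall>\<^sub>F j in sequentially. ereal (real_of_int (X k' - X k)) = XDP G (x k') (w j) - XDP G (x k) (w j)"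
    if w: "inj w" "\<And>j. ?reach (x k) (w j)" "\<And>j. ?reach (x k') (w j)" for k k' and w :: "nat \<Rightarrow> 'v"
  proof -
    from Xdiff[of k k'] obtain C where
      "finite C \<and> (\<forall>w. w \<notin> C \<longrightarrow> ?reach (x k) w \<longrightarrow> ?reach (x k') w \<longrightarrow> ?D (x k) (x k') w = X k' - X k)"
      by (elim exE)
    then have C: "finite C"
      "\<And>w. w \<notin> C \<Longrightarrow> ?reach (x k) w \<Longrightarrow> ?reach (x k') w \<Longrightarrow> ?D (x k) (x k') w = X k' - X k"
      by simp_all
    \<comment> \<open>Distinctness of the \<open>w j\<close> enters here: only finitely many of them
      lie in the exceptional set.\<close>
    have "finite (w -` C)" using C(1) w(1) by (rule finite_vimageI)
    then have "\<forall>\<^sub>F j in sequentially. w j \<notin> C"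
      by (simp add: eventually_cofinite flip: cofinite_eq_sequentially) (simp add: vimage_def)
    then show ?thesis
    proof eventually_elim
      case (elim j)
      from C(2)[OF elim w(2,3)] have "real_of_int (X k' - X k) = real (d (x k') (w j)) - real (d (x k) (w j))"
        by linarith
      then show ?case by (simp only: d[OF w(2)] d[OF w(3)] ereal_minus)
    qed
  qed
  show ?thesis
  proof (rule ex1I[of _ X], intro conjI allI impI X0)
    fix k k' and w :: "nat \<Rightarrow> 'v"
    assume "inj w \<and> range w \<subseteq> verts G \<and> (\<forall>j. ?reach (x k) (w j) \<and> ?reach (x k') (w j))"
    then show "\<forall>\<^sub>F j in sequentially. ereal (real_of_int (X k' - X k)) = XDP G (x k') (w j) - XDP G (x k) (w j)"
      using lim by blast
  next
    fix Y :: "int \<Rightarrow> int"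
    assume Y: "Y 0 = 0 \<and> (\<forall>k k'. \<forall>w :: nat \<Rightarrow> 'v.
            inj w \<and> range w \<subseteq> verts G \<and> (\<forall>j. ?reach (x k) (w j) \<and> ?reach (x k') (w j)) \<longrightarrow>
            (\<forall>\<^sub>F j in sequentially.
               ereal (real_of_int (Y k' - Y k)) = XDP G (x k') (w j) - XDP G (x k) (w j)))"
    show "Y = X"
    proof
      fix k
      obtain w :: "nat \<Rightarrow> 'v" where w: "inj w" "range w \<subseteq> {w. ?reach (x 0) w \<and> ?reach (x k) w}"
        using infinite_countable_subset[OF common[OF x x]] by blast
      have "range w \<subseteq> verts G" using w(2) directed_path_verts[OF wf] by blast
      with w have "\<forall>\<^sub>F j in sequentially. ereal (real_of_int (Y k - Y 0)) = XDP G (x k) (w j) - XDP G (x 0) (w j)"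
        "\<forall>\<^sub>F j in sequentially. ereal (real_of_int (X k - X 0)) = XDP G (x k) (w j) - XDP G (x 0) (w j)"
        using Y lim[of w 0 k] by blast+
      then have "\<forall>\<^sub>F j in sequentially. ereal (real_of_int (Y k - Y 0)) = ereal (real_of_int (X k - X 0))"
        by eventually_elim simp
      then show "Y k = X k" using Y X0 by simp
    qed
  qed
qed

section \<open>Geometry of the KMSW procedure\<close>

text \<open>The pathwise counterpart of \<open>survival\<close>, used with the same step
  functions.\<close>

primrec run :: "('c \<Rightarrow> 's \<Rightarrow> 's) \<Rightarrow> (nat \<Rightarrow> 'c) \<Rightarrow> 's \<Rightarrow> nat \<Rightarrow> 's" where
  "run F c x 0 = x"
| "run F c x (Suc n) = F (c n) (run F c x n)"

text \<open>Listed from the apex backwards: the procedure acts at the active edge, so a step changes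
  either stack at its head only.\<close>

definition left_stack :: "kmsw_map \<Rightarrow> nat list" where
  "left_stack m = rev (map initial_vertex (upper_left m))"

definition apex :: "kmsw_map \<Rightarrow> nat" where
  "apex m = terminal_vertex (active m)"

definition right_stack :: "kmsw_map \<Rightarrow> nat list" where
  "right_stack m = map terminal_vertex (upper_right m)"

definition front :: "kmsw_map \<Rightarrow> nat set" where
  "front m = set (left_stack m) \<union> {apex m} \<union> set (right_stack m)"

lemmas front_defs = left_stack_def apex_def active_def right_stack_def

text \<open>
  \<open>A\<close> is closed under the arcs of \<open>m\<close> and contains exactly the last \<open>z + q\<close> vertices of the upper
  boundary, where \<open>q\<close> is the number of vertices after the apex; \<open>front_step\<close> describes how
  \<open>(z, q)\<close> evolves.
\<close>

definition marked_front :: "nat set \<Rightarrow> int \<Rightarrow> nat \<Rightarrow> kmsw_map \<Rightarrow> bool" where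
  "marked_front A z q m \<longleftrightarrow> A \<subseteq> vertices m \<and>
    (\<forall>e \<in> edges m. initial_vertex e \<in> A \<longrightarrow> terminal_vertex e \<in> A) \<and>
    q = length (upper_right m) \<and> z + int q \<ge> 1 \<and> z \<le> int (length (upper_left m)) + 1 \<and>
    (\<forall>i < length (left_stack m). left_stack m ! i \<in> A \<longleftrightarrow> int i + 2 \<le> z) \<and>
    (apex m \<in> A \<longleftrightarrow> 1 \<le> z) \<and>
    (\<forall>i < length (right_stack m). right_stack m ! i \<in> A \<longleftrightarrow> - z \<le> int i)"

section \<open>Transitions of the explored map\<close>

locale kmsw_walk =
  fixes W :: "nat \<Rightarrow> int \<times> int"
  assumes increments: "W (Suc j) - W j \<in> kmsw_increments"
begin

abbreviation M :: "nat \<Rightarrow> kmsw_map" where "M \<equiv> kmsw W"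
abbreviation inc :: "nat \<Rightarrow> int \<times> int" where "inc j \<equiv> W (Suc j) - W j"

lemma step_cases:
  obtains
    (edge) f fs where "inc j = (1,-1)" "upper_right (M j) = f # fs" "initial_vertex f = apex (M j)"
      "vertices (M (Suc j)) = vertices (M j)" "edges (M (Suc j)) = insert f (edges (M j))"
      "upper_left (M (Suc j)) = upper_left (M j) @ [f]" "upper_right (M (Suc j)) = fs"
      "lower_left (M (Suc j)) = lower_left (M j)" "lower_right (M (Suc j)) = lower_right (M j)"
  | (new_edge) e where "inc j = (1,-1)" "upper_right (M j) = []" "e = Edge (Suc j) (apex (M j)) (Suc (Suc j))"
      "vertices (M (Suc j)) = insert (Suc (Suc j)) (vertices (M j))" "edges (M (Suc j)) = insert e (edges (M j))"
      "upper_left (M (Suc j)) = upper_left (M j) @ [e]" "upper_right (M (Suc j)) = []"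
      "lower_left (M (Suc j)) = lower_left (M j)" "lower_right (M (Suc j)) = lower_right (M j) @ [e]"
  | (left) us e a n where "inc j = (-1,0)" "upper_left (M j) = us @ [e, a]" "terminal_vertex e = initial_vertex a"
      "n = Edge (Suc j) (initial_vertex e) (terminal_vertex a)"
      "vertices (M (Suc j)) = vertices (M j)" "edges (M (Suc j)) = insert n (edges (M j))"
      "upper_left (M (Suc j)) = us @ [n]" "upper_right (M (Suc j)) = upper_right (M j)"
      "lower_left (M (Suc j)) = lower_left (M j)" "lower_right (M (Suc j)) = lower_right (M j)"
  | (new_left) a n where "inc j = (-1,0)" "upper_left (M j) = [a]"
      "n = Edge (Suc j) (Suc (Suc j)) (terminal_vertex a)"
      "vertices (M (Suc j)) = insert (Suc (Suc j)) (vertices (M j))" "edges (M (Suc j)) = insert n (edges (M j))"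
      "upper_left (M (Suc j)) = [n]" "upper_right (M (Suc j)) = upper_right (M j)"
      "lower_left (M (Suc j)) = Edge (Suc j) (Suc (Suc j)) (initial_vertex a) # lower_left (M j)"
      "lower_right (M (Suc j)) = lower_right (M j)"
  | (right) us a n where "inc j = (0,1)" "upper_left (M j) = us @ [a]"
      "n = Edge (Suc j) (initial_vertex a) (Suc (Suc j))"
      "vertices (M (Suc j)) = insert (Suc (Suc j)) (vertices (M j))" "edges (M (Suc j)) = insert n (edges (M j))"
      "upper_left (M (Suc j)) = us @ [n]"
      "upper_right (M (Suc j)) = Edge (Suc j) (Suc (Suc j)) (terminal_vertex a) # upper_right (M j)"
      "lower_left (M (Suc j)) = lower_left (M j)" "lower_right (M (Suc j)) = lower_right (M j)"
proof -
  have ok: "boundary_ok (M j)" by (rule boundary_ok_kmsw)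
  then obtain us a where ul: "upper_left (M j) = us @ [a]"
    by (metis boundary_ok_def rev_exhaust)
  consider "inc j = (1,-1)" | "inc j = (-1,0)" | "inc j = (0,1)"
    using increments[of j] by (auto simp: kmsw_increments_def)
  then show thesis
  proof cases
    case 1
    show thesis
    proof (cases "upper_right (M j)")
      case Nil
      with 1 show thesis
        by (intro new_edge) (simp_all add: kmsw_step_def kmsw_defs Let_def apex_def)
    next
      case (Cons f fs)
      with 1 upper_right_first[OF Cons] show thesis
        by (intro edge) (simp_all add: kmsw_step_def kmsw_defs Let_def apex_def)
    qed
  next
    case 2
    show thesis
    proof (cases us rule: rev_cases)
      case Nil
      with 2 ul show thesis
        by (intro new_left[of a]) (simp_all add: kmsw_step_def kmsw_defs Let_def)
    next
      case (snoc vs e)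
      have "terminal_vertex e = initial_vertex a"
        using ok ul snoc by (auto simp: boundary_ok_def edge_chain_append pre_digraph.cas.simps)
      with 2 ul snoc show thesis
        by (intro left[of vs e a]) (simp_all add: kmsw_step_def kmsw_defs Let_def butlast_append)
    qed
  next
    case 3
    with ul show thesis
      by (intro right[of us a]) (simp_all add: kmsw_step_def kmsw_defs Let_def)
  qed
qed

lemma upper_left_nonempty: "upper_left (M j) \<noteq> []"
  using boundary_ok_kmsw[of W j] by (simp add: boundary_ok_def)

definition endpoints_in :: "nat set \<Rightarrow> edge set \<Rightarrow> bool" where
  "endpoints_in V E \<longleftrightarrow> (\<forall>e\<in>E. initial_vertex e \<in> V \<and> terminal_vertex e \<in> V)"

lemma endpoints_in_simps [simp]:
  "endpoints_in V (insert e E) \<longleftrightarrow> initial_vertex e \<in> V \<and> terminal_vertex e \<in> V \<and> endpoints_in V E"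
  "endpoints_in V {}"
  "endpoints_in V (E \<union> E') \<longleftrightarrow> endpoints_in V E \<and> endpoints_in V E'"
  by (auto simp: endpoints_in_def)

lemma endpoints_in_mono: "endpoints_in V E \<Longrightarrow> V \<subseteq> V' \<Longrightarrow> endpoints_in V' E"
  by (auto simp: endpoints_in_def)

text \<open>The bound \<open>{..Suc j}\<close> makes the next vertex name fresh. Missing edges on
  the upper right are covered since they may become arcs later, those on the lower left since they
  carry boundary vertices.\<close>

lemma well_formed:
  "set (upper_left (M j)) \<subseteq> edges (M j) \<and> set (lower_right (M j)) \<subseteq> edges (M j) \<and>
   endpoints_in (vertices (M j)) (edges (M j) \<union> set (upper_right (M j)) \<union> set (lower_left (M j))) \<and>
   vertices (M j) \<subseteq> {..Suc j}"
proof (induction j)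
  case 0
  show ?case by (auto simp: kmsw_init_def)
next
  case (Suc j)
  have mono: "endpoints_in (insert v (vertices (M j))) E" if "endpoints_in (vertices (M j)) E" for v E
    using endpoints_in_mono[OF that] by blast
  have V: "insert (Suc (Suc j)) (vertices (M j)) \<subseteq> {..Suc (Suc j)}" "vertices (M j) \<subseteq> {..Suc (Suc j)}"
    using Suc by auto
  have UL: "initial_vertex e \<in> vertices (M j)" "terminal_vertex e \<in> vertices (M j)" if "e \<in> set (upper_left (M j))" for e
    using that Suc by (auto simp: endpoints_in_def)
  have ap: "apex (M j) \<in> vertices (M j)"
    using UL(2)[of "last (upper_left (M j))"] upper_left_nonempty by (simp add: apex_def active_def)
  show ?case
    by (cases rule: step_cases[of j]) (use Suc UL ap V mono in \<open>simp_all, auto\<close>)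
qed

lemma new_vertex: "Suc (Suc j) \<notin> vertices (M j)"
  and finite_vertices: "finite (vertices (M j))"
  and upper_left_edges: "set (upper_left (M j)) \<subseteq> edges (M j)"
  and lower_right_edges: "set (lower_right (M j)) \<subseteq> edges (M j)"
  using well_formed[of j] finite_subset[of "vertices (M j)"] by auto

lemma edge_vertices:
  assumes "e \<in> edges (M j) \<or> e \<in> set (upper_right (M j)) \<or> e \<in> set (lower_left (M j))"
  shows "initial_vertex e \<in> vertices (M j)" "terminal_vertex e \<in> vertices (M j)"
  using assms well_formed[of j] by (auto simp: endpoints_in_def)

lemma front_vertices: "front (M j) \<subseteq> vertices (M j)"
proof -
  have "last (upper_left (M j)) \<in> edges (M j)"
    using upper_left_nonempty upper_left_edges last_in_set by blast
  then show ?thesis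
    using upper_left_edges edge_vertices by (auto simp: front_def front_defs)
qed

lemma kmsw_mono_step:
  "vertices (M j) \<subseteq> vertices (M (Suc j)) \<and> edges (M j) \<subseteq> edges (M (Suc j)) \<and>
   edges (M j) \<union> set (upper_right (M j)) \<subseteq> edges (M (Suc j)) \<union> set (upper_right (M (Suc j))) \<and>
   length (lower_left (M j)) \<le> length (lower_left (M (Suc j))) \<and>
   length (lower_right (M j)) \<le> length (lower_right (M (Suc j)))"
  by (cases rule: step_cases[of j]) (simp_all, auto)

lemma kmsw_mono:
  assumes "i \<le> j"
  shows "vertices (M i) \<subseteq> vertices (M j)" "edges (M i) \<subseteq> edges (M j)"
    "edges (M i) \<union> set (upper_right (M i)) \<subseteq> edges (M j) \<union> set (upper_right (M j))"
    "length (lower_left (M i)) \<le> length (lower_left (M j))"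
    "length (lower_right (M i)) \<le> length (lower_right (M j))"
  using assms by (induction j rule: dec_induct) (use kmsw_mono_step in \<open>(blast intro: le_trans)+\<close>)

section \<open>Acyclicity and reachability\<close>

text \<open>
  The map is acyclic since new vertices are sources, sinks, or subdivide an edge; for the last of
  these, the missing edges on the upper right have to be taken into account.
\<close>

lemma height_exists:
  "\<exists>h :: nat \<Rightarrow> real. \<forall>e \<in> edges (M j) \<union> set (upper_right (M j)). h (initial_vertex e) < h (terminal_vertex e)"
proof (induction j)
  case 0
  show ?case by (intro exI[of _ real]) (simp add: kmsw_init_def)
next
  case (Suc j)
  then obtain h :: "nat \<Rightarrow> real" where
    h: "\<And>e. e \<in> edges (M j) \<union> set (upper_right (M j)) \<Longrightarrow> h (initial_vertex e) < h (terminal_vertex e)" by blast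
  have old: "(h(Suc (Suc j) := y)) (initial_vertex e) < (h(Suc (Suc j) := y)) (terminal_vertex e)"
    if "e \<in> edges (M j) \<union> set (upper_right (M j))" for e y
    using h[OF that] edge_vertices[of e j] new_vertex[of j] that by auto
  have UL: "h (initial_vertex e) < h (terminal_vertex e)" if "e \<in> set (upper_left (M j))" for e
    using that h upper_left_edges by blast
  have in_V: "v \<noteq> Suc (Suc j)" if "v \<in> vertices (M j)" for v
    using that new_vertex by auto
  have UL_V: "initial_vertex e \<in> vertices (M j)" "terminal_vertex e \<in> vertices (M j)" if "e \<in> set (upper_left (M j))" for e
    using that upper_left_edges edge_vertices by blast+
  have ap: "apex (M j) \<in> vertices (M j)" using front_vertices by (auto simp: front_def)
  show ?case
  proof (cases rule: step_cases[of j])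
    case (edge f fs)
    then show ?thesis using h by (intro exI[of _ h]) auto
  next
    case (new_edge e)
    let ?h = "h(Suc (Suc j) := h (apex (M j)) + 1)"
    have "?h (initial_vertex e) < ?h (terminal_vertex e)" using new_edge in_V[OF ap] by simp
    then show ?thesis using old new_edge by (intro exI[of _ ?h]) auto
  next
    case (left us e a n)
    have "h (initial_vertex n) < h (terminal_vertex n)"
      using UL[of e] UL[of a] left by simp
    then show ?thesis using left h by (intro exI[of _ h]) auto
  next
    case (new_left a n)
    let ?h = "h(Suc (Suc j) := h (terminal_vertex a) - 1)"
    have "?h (initial_vertex n) < ?h (terminal_vertex n)" using new_left in_V[OF UL_V(2)[of a]] by simp
    then show ?thesis using old new_left by (intro exI[of _ ?h]) auto
  next
    case (right us a n)
    let ?h = "h(Suc (Suc j) := (h (initial_vertex a) + h (terminal_vertex a)) / 2)"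
    have a: "a \<in> set (upper_left (M j))" using right by simp
    have "?h (initial_vertex n) < ?h (terminal_vertex n)" "?h (Suc (Suc j)) < ?h (terminal_vertex a)"
      using right in_V[OF UL_V(1)[OF a]] in_V[OF UL_V(2)[OF a]] UL[OF a] by simp_all
    then show ?thesis using old right by (intro exI[of _ ?h]) auto
  qed
qed

definition arc_rel :: "edge set \<Rightarrow> (nat \<times> nat) set" where
  "arc_rel E = (\<lambda>e. (initial_vertex e, terminal_vertex e)) ` E"

definition last_vertex :: "nat \<Rightarrow> nat" where
  "last_vertex j = (if upper_right (M j) = [] then apex (M j) else terminal_vertex (last (upper_right (M j))))"

text \<open>Only the case \<open>new_edge\<close> moves the last vertex, and then along an arc from
  the old one. Every other new vertex has an arc, possibly still missing, to an old vertex.\<close>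

lemma reaches_last_vertex:
  "v \<in> vertices (M j) \<Longrightarrow> (v, last_vertex j) \<in> (arc_rel (edges (M j) \<union> set (upper_right (M j))))\<^sup>*"
proof (induction j arbitrary: v)
  case 0
  then show ?case
    by (auto simp: kmsw_init_def last_vertex_def apex_def active_def arc_rel_def)
next
  case (Suc j)
  let ?R = "\<lambda>j. arc_rel (edges (M j) \<union> set (upper_right (M j)))"
  have sub: "?R j \<subseteq> ?R (Suc j)" using kmsw_mono(3)[of j "Suc j"] by (auto simp: arc_rel_def)
  have IH: "(v, last_vertex j) \<in> (?R (Suc j))\<^sup>*" if "v \<in> vertices (M j)" for v
    using Suc.IH[OF that] rtrancl_mono[OF sub] by blast
  have ap: "apex (M j) \<in> vertices (M j)" using front_vertices by (auto simp: front_def)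
  have UL_V: "terminal_vertex e \<in> vertices (M j)" if "e \<in> set (upper_left (M j))" for e
    using that upper_left_edges edge_vertices by blast
  show ?case
  proof (cases rule: step_cases[of j])
    case (edge f fs)
    then have "last_vertex (Suc j) = last_vertex j" by (auto simp: last_vertex_def apex_def active_def)
    then show ?thesis using IH Suc.prems edge by simp
  next
    case (new_edge e)
    then have l: "last_vertex (Suc j) = Suc (Suc j)" "last_vertex j = apex (M j)"
      by (auto simp: last_vertex_def apex_def active_def)
    have "(apex (M j), Suc (Suc j)) \<in> ?R (Suc j)"
      using new_edge by (auto simp: arc_rel_def)
    then show ?thesis using IH[of v] Suc.prems l new_edge by auto
  next
    case (left us e a n)
    then have "last_vertex (Suc j) = last_vertex j" by (auto simp: last_vertex_def apex_def active_def)
    then show ?thesis using IH Suc.prems left by simp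
  next
    case (new_left a n)
    then have l: "last_vertex (Suc j) = last_vertex j" by (auto simp: last_vertex_def apex_def active_def)
    have "(Suc (Suc j), terminal_vertex a) \<in> ?R (Suc j)" using new_left by (auto simp: arc_rel_def)
    then have "(Suc (Suc j), last_vertex j) \<in> (?R (Suc j))\<^sup>*"
      using IH[OF UL_V[of a]] new_left by (simp add: converse_rtrancl_into_rtrancl)
    then show ?thesis using IH[of v] Suc.prems l new_left by auto
  next
    case (right us a n)
    then have l: "last_vertex (Suc j) = last_vertex j" by (auto simp: last_vertex_def apex_def active_def)
    have "(Suc (Suc j), terminal_vertex a) \<in> ?R (Suc j)" using right by (auto simp: arc_rel_def)
    then have "(Suc (Suc j), last_vertex j) \<in> (?R (Suc j))\<^sup>*"
      using IH[OF UL_V[of a]] right by (simp add: converse_rtrancl_into_rtrancl)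
    then show ?thesis using IH[of v] Suc.prems l right by auto
  qed
qed

section \<open>Evolution of the front\<close>

lemma front_step_subset:
  "front (M (Suc j)) \<subseteq> insert (Suc (Suc j)) (front (M j))"
  by (cases rule: step_cases[of j]) (auto simp: front_def front_defs)

lemma new_arc_from_front:
  "e \<in> edges (M (Suc j)) \<Longrightarrow> e \<in> edges (M j) \<or> initial_vertex e \<in> insert (Suc (Suc j)) (front (M j))"
  by (cases rule: step_cases[of j]) (auto simp: front_def front_defs)

text \<open>A vertex that has left the upper boundary never comes back, and new arcs start on the
  boundary or at a new vertex. So a vertex of \<open>M i\<close> gains outgoing arcs later only if
  it lies on the boundary at time \<open>i\<close>.\<close>

lemma later_arc_from_front:
  assumes "i \<le> j"
  shows "front (M j) \<inter> vertices (M i) \<subseteq> front (M i) \<and>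
    (\<forall>e \<in> edges (M j) - edges (M i). initial_vertex e \<in> vertices (M i) \<longrightarrow> initial_vertex e \<in> front (M i))"
  using assms
proof (induction j rule: dec_induct)
  case (step j)
  have "Suc (Suc j) \<notin> vertices (M i)" using new_vertex kmsw_mono(1)[OF step.hyps(1)] by blast
  then have f: "front (M (Suc j)) \<inter> vertices (M i) \<subseteq> front (M i)"
    using step.IH front_step_subset[of j] by blast
  have "initial_vertex e \<in> front (M i)"
    if "e \<in> edges (M (Suc j)) - edges (M i)" "initial_vertex e \<in> vertices (M i)" for e
  proof (cases "e \<in> edges (M j)")
    case False
    with new_arc_from_front[of e j] that \<open>Suc (Suc j) \<notin> vertices (M i)\<close> have "initial_vertex e \<in> front (M j)" by auto
    with that step.IH show ?thesis by blast
  qed (use that step.IH in blast)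
  with f show ?case by blast
qed simp

text \<open>At time \<open>T\<close> the whole boundary is marked, hence the initial state. A new
  vertex joins \<open>A\<close> exactly when an arc created with it leads to it from
  \<open>A\<close>, which keeps \<open>A\<close> closed.\<close>

lemma marked_front_exists:
  assumes "run front_step (\<lambda>n. inc (T + n)) (int (length (upper_left (M T))) + 1, length (upper_right (M T))) n = (z, q)"
  shows "\<exists>A. vertices (M T) \<subseteq> A \<and> marked_front A z q (M (T + n))"
  using assms
proof (induction n arbitrary: z q)
  case 0
  let ?V = "vertices (M T)"
  have f: "front (M T) \<subseteq> ?V" by (rule front_vertices)
  have "left_stack (M T) ! i \<in> ?V" if "i < length (left_stack (M T))" for i
    using f nth_mem[OF that] by (auto simp: front_def)
  moreover have "right_stack (M T) ! i \<in> ?V" if "i < length (right_stack (M T))" for i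
    using f nth_mem[OF that] by (auto simp: front_def)
  moreover have "apex (M T) \<in> ?V" using f by (auto simp: front_def)
  ultimately show ?case using 0 edge_vertices[of _ T]
    by (intro exI[of _ ?V]) (auto simp: marked_front_def left_stack_def)
next
  case (Suc n)
  define j where "j = T + n"
  obtain z' q' where zq': "run front_step (\<lambda>n. inc (T + n))
      (int (length (upper_left (M T))) + 1, length (upper_right (M T))) n = (z', q')"
    by (meson surj_pair)
  with Suc.prems have zq: "(z, q) = front_step (inc j) (z', q')" by (simp add: j_def)
  from Suc.IH[OF zq', folded j_def] obtain A where A: "vertices (M T) \<subseteq> A" "A \<subseteq> vertices (M j)"
    and cl: "\<And>e. e \<in> edges (M j) \<Longrightarrow> initial_vertex e \<in> A \<Longrightarrow> terminal_vertex e \<in> A"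
    and q: "q' = length (upper_right (M j))" "z' + int q' \<ge> 1" "z' \<le> int (length (upper_left (M j))) + 1"
    and L: "\<And>i. i < length (left_stack (M j)) \<Longrightarrow> left_stack (M j) ! i \<in> A \<longleftrightarrow> int i + 2 \<le> z'"
    and P: "apex (M j) \<in> A \<longleftrightarrow> 1 \<le> z'"
    and R: "\<And>i. i < length (right_stack (M j)) \<Longrightarrow> right_stack (M j) ! i \<in> A \<longleftrightarrow> - z' \<le> int i"
    unfolding marked_front_def by blast
  let ?v = "Suc (Suc j)"
  have v: "?v \<notin> vertices (M j)" by (rule new_vertex)
  then have vA: "?v \<notin> A" using A by blast
  have clv: "terminal_vertex e \<in> insert ?v A" if "e \<in> edges (M j)" "initial_vertex e \<in> insert ?v A" for e
    using cl[OF that(1)] v edge_vertices(1)[of e j] that by auto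
  have Lv: "left_stack (M j) ! i \<noteq> ?v" if "i < length (left_stack (M j))" for i
    using nth_mem[OF that] front_vertices[of j] v by (auto simp: front_def)
  have Rv: "right_stack (M j) ! i \<noteq> ?v" if "i < length (right_stack (M j))" for i
    using nth_mem[OF that] front_vertices[of j] v by (auto simp: front_def)
  have Pv: "apex (M j) \<noteq> ?v" using front_vertices[of j] v by (auto simp: front_def)
  have "\<exists>A. vertices (M T) \<subseteq> A \<and> marked_front A z q (M (Suc j))"
  proof (cases rule: step_cases[of j])
    case (edge f fs)
    have s: "left_stack (M (Suc j)) = apex (M j) # left_stack (M j)" "apex (M (Suc j)) = terminal_vertex f"
      "right_stack (M j) = terminal_vertex f # right_stack (M (Suc j))"
      using edge by (simp_all add: front_defs)
    \<comment> \<open>The marked vertices form a final segment, so a marked apex has a marked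
      successor, and \<open>A\<close> stays closed when the missing edge \<open>f\<close> becomes an
      arc.\<close>
    have f: "terminal_vertex f \<in> A \<longleftrightarrow> 0 \<le> z'" using R[of 0] s by simp
    have "marked_front A z q (M (Suc j))"
      unfolding marked_front_def
    proof (intro conjI allI impI ballI)
      fix i assume "i < length (left_stack (M (Suc j)))"
      then show "left_stack (M (Suc j)) ! i \<in> A \<longleftrightarrow> int i + 2 \<le> z"
        using L[of "i - 1"] P edge zq s by (cases i) (auto simp: front_step_def)
    next
      fix i assume "i < length (right_stack (M (Suc j)))"
      then show "right_stack (M (Suc j)) ! i \<in> A \<longleftrightarrow> - z \<le> int i"
        using R[of "Suc i"] edge zq s by (auto simp: front_step_def)
    next
      fix e assume "e \<in> edges (M (Suc j))" "initial_vertex e \<in> A"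
      then show "terminal_vertex e \<in> A" using edge cl P f by auto
    qed (use A q edge zq s f in \<open>auto simp: front_step_def\<close>)
    with A(1) show ?thesis by blast
  next
    case (new_edge e)
    \<comment> \<open>With \<open>q' = 0\<close> the apex is marked, and so is the new vertex after
      it; the truncated \<open>q - 1\<close> in \<open>front_step\<close> accounts for this.\<close>
    have z1: "z' \<ge> 1" using q new_edge by simp
    have s: "left_stack (M (Suc j)) = apex (M j) # left_stack (M j)" "apex (M (Suc j)) = ?v"
      "right_stack (M (Suc j)) = []"
      using new_edge by (simp_all add: front_defs)
    have "marked_front (insert ?v A) z q (M (Suc j))"
      unfolding marked_front_def
    proof (intro conjI allI impI ballI)
      fix i assume "i < length (left_stack (M (Suc j)))"
      then show "left_stack (M (Suc j)) ! i \<in> insert ?v A \<longleftrightarrow> int i + 2 \<le> z"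
        using L[of "i - 1"] Lv[of "i - 1"] P Pv new_edge zq s by (cases i) (auto simp: front_step_def)
    next
      fix d assume "d \<in> edges (M (Suc j))" "initial_vertex d \<in> insert ?v A"
      then show "terminal_vertex d \<in> insert ?v A" using new_edge clv by auto
    qed (use A q new_edge zq s z1 in \<open>auto simp: front_step_def\<close>)
    with A(1) show ?thesis by blast
  next
    case (left us e a n)
    have s: "left_stack (M j) = initial_vertex a # left_stack (M (Suc j))" "apex (M (Suc j)) = apex (M j)"
      "right_stack (M (Suc j)) = right_stack (M j)"
      using left by (simp_all add: front_defs)
    have ea: "e \<in> edges (M j)" "a \<in> edges (M j)" using upper_left_edges[of j] left by auto
    have "marked_front A z q (M (Suc j))"
      unfolding marked_front_def
    proof (intro conjI allI impI ballI)
      fix i assume "i < length (left_stack (M (Suc j)))"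
      then show "left_stack (M (Suc j)) ! i \<in> A \<longleftrightarrow> int i + 2 \<le> z"
        using L[of "Suc i"] left zq s by (auto simp: front_step_def split: if_splits)
    next
      fix i assume "i < length (right_stack (M (Suc j)))"
      then show "right_stack (M (Suc j)) ! i \<in> A \<longleftrightarrow> - z \<le> int i"
        using R[of i] left zq s by (auto simp: front_step_def split: if_splits)
    next
      fix d assume "d \<in> edges (M (Suc j))" "initial_vertex d \<in> A"
      \<comment> \<open>The new arc is a shortcut for \<open>e\<close> followed by
        \<open>a\<close>.\<close>
      moreover have "terminal_vertex a \<in> A" if "initial_vertex e \<in> A"
        using cl[OF ea(1) that] cl[OF ea(2)] left(3) by simp
      ultimately show "terminal_vertex d \<in> A" using left(4,6) cl by auto
    qed (use A q left zq s P in \<open>auto simp: front_step_def split: if_splits\<close>)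
    with A(1) show ?thesis by blast
  next
    case (new_left a n)
    have s: "left_stack (M j) = [initial_vertex a]" "left_stack (M (Suc j)) = [?v]" "apex (M (Suc j)) = apex (M j)"
      "right_stack (M (Suc j)) = right_stack (M j)"
      using new_left by (simp_all add: front_defs)
    \<comment> \<open>The new vertex is a source and stays unmarked. Here \<open>z' \<le> 2\<close>,
      and the value 2 drops to 1 because a marked vertex is covered.\<close>
    have "marked_front A z q (M (Suc j))"
      unfolding marked_front_def
    proof (intro conjI allI impI ballI)
      fix i assume "i < length (left_stack (M (Suc j)))"
      then show "left_stack (M (Suc j)) ! i \<in> A \<longleftrightarrow> int i + 2 \<le> z"
        using vA q new_left zq s by (auto simp: front_step_def split: if_splits)
    next
      fix i assume "i < length (right_stack (M (Suc j)))"
      then show "right_stack (M (Suc j)) ! i \<in> A \<longleftrightarrow> - z \<le> int i"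
        using R[of i] new_left zq s by (auto simp: front_step_def split: if_splits)
    next
      fix d assume "d \<in> edges (M (Suc j))" "initial_vertex d \<in> A"
      then show "terminal_vertex d \<in> A" using new_left cl vA by auto
    qed (use A q new_left zq s P in \<open>auto simp: front_step_def split: if_splits\<close>)
    with A(1) show ?thesis by blast
  next
    case (right us a n)
    have s: "left_stack (M (Suc j)) = left_stack (M j)" "apex (M (Suc j)) = ?v"
      "right_stack (M (Suc j)) = apex (M j) # right_stack (M j)" "left_stack (M j) = initial_vertex a # rev (map initial_vertex us)"
      using right by (simp_all add: front_defs)
    have a: "initial_vertex a \<in> A \<longleftrightarrow> 2 \<le> z'" using L[of 0] s by simp
    \<comment> \<open>The arc to the new vertex starts at the initial vertex of \<open>a\<close>,
      which is marked exactly when \<open>z' \<ge> 2\<close>.\<close>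
    define B where "B = (if z' \<ge> 2 then insert ?v A else A)"
    have B: "x \<in> B \<longleftrightarrow> x \<in> A \<or> x = ?v \<and> z' \<ge> 2" for x by (auto simp: B_def)
    have "marked_front B z q (M (Suc j))"
      unfolding marked_front_def
    proof (intro conjI allI impI ballI)
      fix i assume "i < length (left_stack (M (Suc j)))"
      then show "left_stack (M (Suc j)) ! i \<in> B \<longleftrightarrow> int i + 2 \<le> z"
        using L[of i] Lv[of i] right zq s(1) B by (auto simp: front_step_def split: if_splits)
    next
      fix i assume "i < length (right_stack (M (Suc j)))"
      then show "right_stack (M (Suc j)) ! i \<in> B \<longleftrightarrow> - z \<le> int i"
        using R[of "i - 1"] Rv[of "i - 1"] P Pv right zq s(3) B by (cases i) (auto simp: front_step_def split: if_splits)
    next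
      fix d assume d: "d \<in> edges (M (Suc j))" "initial_vertex d \<in> B"
      show "terminal_vertex d \<in> B"
      proof (cases "d = n")
        case True
        have "initial_vertex a \<noteq> ?v" using Lv[of 0] s(4) by simp
        then show ?thesis using d a right True B by auto
      next
        case False
        then have "d \<in> edges (M j)" using d right by simp
        then show ?thesis using cl clv d(2) unfolding B_def by (auto split: if_splits)
      qed
    qed (use A q right zq s vA B in \<open>auto simp: front_step_def split: if_splits\<close>)
    with A(1) B show ?thesis by blast
  qed
  then show ?case by (simp add: j_def)
qed

text \<open>Before the first such step the walk equals one plus the length of
  \<open>upper_right\<close>, which is never 0.\<close>

lemma east_growth:
  assumes "run east_step (\<lambda>n. inc (T + n)) (Suc (length (upper_right (M T)))) n = 0"
  shows "\<exists>i\<ge>T. upper_right (M i) = [] \<and> inc i = (1,-1)"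
proof (rule ccontr)
  assume *: "\<not> ?thesis"
  have "run east_step (\<lambda>n. inc (T + n)) (Suc (length (upper_right (M T)))) n = Suc (length (upper_right (M (T + n))))" for n
  proof (induction n)
    case (Suc n)
    then show ?case using *[simplified, rule_format, of "T + n"]
      by (cases rule: step_cases[of "T + n"]) (auto simp: east_step_def)
  qed simp
  with assms show False by simp
qed

lemma west_growth:
  assumes "run west_step (\<lambda>n. inc (T + n)) (length (upper_left (M T))) n = 0"
  shows "\<exists>i\<ge>T. length (upper_left (M i)) = 1 \<and> inc i = (-1,0)"
proof (rule ccontr)
  assume *: "\<not> ?thesis"
  have "run west_step (\<lambda>n. inc (T + n)) (length (upper_left (M T))) n = length (upper_left (M (T + n)))" for n
  proof (induction n)
    case (Suc n)
    then show ?case using *[simplified, rule_format, of "T + n"]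
      by (cases rule: step_cases[of "T + n"]) (auto simp: west_step_def)
  qed simp
  with assms upper_left_nonempty show False by simp
qed

section \<open>Directed paths in the limit map\<close>

abbreviation G :: "(nat, edge) pre_digraph" where "G \<equiv> digraph_of (kmsw_union W)"

lemma G_simps [simp]:
  "verts G = (\<Union>j. vertices (M j))" "arcs G = (\<Union>j. edges (M j))"
  "tail G = initial_vertex" "head G = terminal_vertex"
  by (simp_all add: digraph_of_def kmsw_union_def)

lemma wf_G: "wf_digraph G"
proof
  fix e assume "e \<in> arcs G"
  then obtain j where "e \<in> edges (M j)" by auto
  then show "tail G e \<in> verts G" "head G e \<in> verts G" using edge_vertices[of e j] by auto
qed

lemma finite_verts_bound:
  assumes "finite F" "F \<subseteq> verts G"
  obtains T where "F \<subseteq> vertices (M T)"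
proof -
  have "\<exists>T. F \<subseteq> vertices (M T)"
    using assms
  proof (induction F rule: finite_induct)
    case (insert v F)
    then obtain T i where "F \<subseteq> vertices (M T)" "v \<in> vertices (M i)" by auto
    then have "insert v F \<subseteq> vertices (M (max T i))"
      using kmsw_mono(1)[of T "max T i"] kmsw_mono(1)[of i "max T i"] by auto
    then show ?case ..
  qed simp
  then show ?thesis using that by blast
qed

lemma finite_arcs_bound:
  assumes "finite F" "F \<subseteq> arcs G"
  obtains T where "F \<subseteq> edges (M T)"
proof -
  have "\<exists>T. F \<subseteq> edges (M T)"
    using assms
  proof (induction F rule: finite_induct)
    case (insert v F)
    then obtain T i where "F \<subseteq> edges (M T)" "v \<in> edges (M i)" by auto
    then have "insert v F \<subseteq> edges (M (max T i))"
      using kmsw_mono(2)[of T "max T i"] kmsw_mono(2)[of i "max T i"] by auto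
    then show ?case ..
  qed simp
  then show ?thesis using that by blast
qed

lemma path_increasing:
  fixes h :: "nat \<Rightarrow> real"
  assumes "pre_digraph.cas G u p v" "\<And>e. e \<in> set p \<Longrightarrow> h (initial_vertex e) < h (terminal_vertex e)"
  shows "distinct (map terminal_vertex p) \<and> (\<forall>e\<in>set p. h u < h (terminal_vertex e)) \<and> (p \<noteq> [] \<longrightarrow> h u < h v)"
  using assms
proof (induction p arbitrary: u)
  case (Cons e p)
  have "initial_vertex e = u" "pre_digraph.cas G (terminal_vertex e) p v"
    using Cons.prems(1) by (auto simp: pre_digraph.cas.simps)
  with Cons.IH[of "terminal_vertex e"] Cons.prems(2) show ?case
    by (cases "p = []") (fastforce simp: pre_digraph.cas.simps)+
qed simp

text \<open>Heights are available for the finite maps, and a path has finitely many arcs, so it lies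
  in one of these.\<close>

lemma path_height:
  assumes "directed_path G u p v"
  obtains h :: "nat \<Rightarrow> real" where "\<And>e. e \<in> set p \<Longrightarrow> h (initial_vertex e) < h (terminal_vertex e)"
proof -
  have "finite (set p)" "set p \<subseteq> arcs G" using assms by (auto simp: directed_path_def pre_digraph.awalk_def)
  then obtain T where T: "set p \<subseteq> edges (M T)" by (rule finite_arcs_bound)
  obtain h :: "nat \<Rightarrow> real" where "\<And>e. e \<in> edges (M T) \<Longrightarrow> h (initial_vertex e) < h (terminal_vertex e)"
    using height_exists[of T] by auto
  with T show ?thesis using that by blast
qed

lemma path_cas: "directed_path G u p v \<Longrightarrow> pre_digraph.cas G u p v"
  by (simp add: directed_path_def pre_digraph.awalk_def)

lemma digraph_acyclic:
  assumes "directed_path G v p v"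
  shows "p = []"
proof -
  obtain h :: "nat \<Rightarrow> real" where "\<And>e. e \<in> set p \<Longrightarrow> h (initial_vertex e) < h (terminal_vertex e)"
    using path_height[OF assms] by blast
  from path_increasing[OF path_cas[OF assms] this] show ?thesis by auto
qed

lemma path_length_le:
  assumes "directed_path G u p v" "finite A" "terminal_vertex ` set p \<subseteq> A"
  shows "length p \<le> card A"
proof -
  obtain h :: "nat \<Rightarrow> real" where "\<And>e. e \<in> set p \<Longrightarrow> h (initial_vertex e) < h (terminal_vertex e)"
    using path_height[OF assms(1)] by blast
  from path_increasing[OF path_cas[OF assms(1)] this] have "distinct (map terminal_vertex p)" by blast
  then have "length p = card (set (map terminal_vertex p))" using distinct_card by fastforce
  also have "\<dots> \<le> card A" using assms by (intro card_mono) auto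
  finally show ?thesis .
qed

lemma path_exit:
  assumes "directed_path G u p w" "u \<in> A" "\<not> terminal_vertex ` set p \<subseteq> A"
  obtains p1 e p2 where "p = p1 @ e # p2" "directed_path G u p1 (initial_vertex e)"
    "directed_path G (initial_vertex e) (e # p2) w" "e \<in> arcs G" "initial_vertex e \<in> A" "terminal_vertex e \<notin> A"
proof -
  have "\<exists>p1 e p2. p = p1 @ e # p2 \<and> directed_path G u p1 (initial_vertex e) \<and>
    directed_path G (initial_vertex e) (e # p2) w \<and> e \<in> arcs G \<and> initial_vertex e \<in> A \<and> terminal_vertex e \<notin> A"
    using assms
  proof (induction p arbitrary: u)
    case (Cons e p)
    then have e: "e \<in> arcs G" "initial_vertex e = u" "u \<in> verts G" "set p \<subseteq> arcs G" "pre_digraph.cas G (terminal_vertex e) p w"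
      by (auto simp: directed_path_def pre_digraph.awalk_def pre_digraph.cas.simps)
    show ?case
    proof (cases "terminal_vertex e \<in> A")
      case False
      then show ?thesis using Cons.prems e by (intro exI[of _ "[]"] exI[of _ e] exI[of _ p]) simp
    next
      case True
      have tv: "terminal_vertex e \<in> verts G" using wf_digraph.head_in_verts[OF wf_G e(1)] by simp
      with e have "directed_path G (terminal_vertex e) p w"
        by (simp add: directed_path_def pre_digraph.awalk_def)
      from Cons.IH[OF this True] Cons.prems(3) True obtain p1 d p2 where
        *: "p = p1 @ d # p2" "directed_path G (terminal_vertex e) p1 (initial_vertex d)"
        "directed_path G (initial_vertex d) (d # p2) w" "d \<in> arcs G" "initial_vertex d \<in> A" "terminal_vertex d \<notin> A"
        by auto
      have "directed_path G u (e # p1) (initial_vertex d)"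
        using *(2) e by (auto simp: directed_path_def pre_digraph.awalk_def pre_digraph.cas.simps)
      with * show ?thesis by (intro exI[of _ "e # p1"] exI[of _ d] exI[of _ p2]) simp
    qed
  qed simp
  then show ?thesis using that by blast
qed

lemma reach_path:
  assumes "(u, v) \<in> (arc_rel (arcs G))\<^sup>*" "u \<in> verts G"
  shows "\<exists>p. directed_path G u p v"
  using assms(1)
proof (induction rule: rtrancl_induct)
  case base
  show ?case using assms(2) by (intro exI[of _ "[]"]) simp
next
  case (step v w)
  then obtain p e where "directed_path G u p v" "e \<in> arcs G" "v = initial_vertex e" "w = terminal_vertex e"
    by (auto simp: arc_rel_def)
  then have "directed_path G u (p @ [e]) w"
    by (auto simp: directed_path_append pre_digraph.cas.simps)
  then show ?case ..
qed

end

section \<open>Consequences of recurrence along a fixed walk\<close>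

text \<open>
  By \<open>marked_front\<close>, the last hypothesis says that at some time after \<open>T\<close> the apex is the only
  vertex on the upper boundary that can be reached from the vertices born before time \<open>T\<close>.
\<close>

locale recurrent_kmsw_walk = kmsw_walk +
  assumes east_recurrent: "\<exists>i\<ge>T. upper_right (M i) = [] \<and> inc i = (1,-1)"
    and west_recurrent: "\<exists>i\<ge>T. length (upper_left (M i)) = 1 \<and> inc i = (-1,0)"
    and front_hits: "\<exists>n. run front_step (\<lambda>n. inc (T + n))
      (int (length (upper_left (M T))) + 1, length (upper_right (M T))) n = (1, 0)"
begin

text \<open>The connection from \<open>reaches_last_vertex\<close> may use missing edges on the
  upper right; once \<open>upper_right\<close> is empty at a later time, they have all become
  arcs.\<close>

lemma path_to_last_vertex:
  assumes "u \<in> vertices (M j)"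
  shows "\<exists>p. directed_path G u p (last_vertex j)"
proof (rule reach_path)
  obtain i where i: "i \<ge> j" "upper_right (M i) = []" using east_recurrent by blast
  have "edges (M j) \<union> set (upper_right (M j)) \<subseteq> arcs G" using kmsw_mono(3)[OF i(1)] i(2) by auto
  then have "arc_rel (edges (M j) \<union> set (upper_right (M j))) \<subseteq> arc_rel (arcs G)" by (auto simp: arc_rel_def)
  from rtrancl_mono[OF this] reaches_last_vertex[OF assms] show "(u, last_vertex j) \<in> (arc_rel (arcs G))\<^sup>*" by blast
  show "u \<in> verts G" using assms by auto
qed

text \<open>At \<open>(1, 0)\<close> the apex is the last boundary vertex and the only marked one.
  Later arcs from older vertices start on that boundary, so \<open>A\<close> can only be left
  through the apex.\<close>

lemma cut_exists:
  obtains J A where "T \<le> J" "vertices (M T) \<subseteq> A" "A \<subseteq> vertices (M J)" "upper_right (M J) = []"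
    "\<And>e. e \<in> arcs G \<Longrightarrow> initial_vertex e \<in> A \<Longrightarrow> terminal_vertex e \<notin> A \<Longrightarrow> initial_vertex e = apex (M J)"
proof -
  obtain n where "run front_step (\<lambda>n. inc (T + n))
      (int (length (upper_left (M T))) + 1, length (upper_right (M T))) n = (1, 0)" using front_hits by blast
  from marked_front_exists[OF this] obtain A where A: "vertices (M T) \<subseteq> A" "A \<subseteq> vertices (M (T + n))"
    and cl: "\<And>e. e \<in> edges (M (T + n)) \<Longrightarrow> initial_vertex e \<in> A \<Longrightarrow> terminal_vertex e \<in> A"
    and r: "upper_right (M (T + n)) = []"
    and l: "\<And>i. i < length (left_stack (M (T + n))) \<Longrightarrow> left_stack (M (T + n)) ! i \<notin> A"
    by (auto simp: marked_front_def)
  have fr: "v = apex (M (T + n))" if "v \<in> front (M (T + n))" "v \<in> A" for v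
    using that l r by (auto simp: front_def right_stack_def in_set_conv_nth)
  have "initial_vertex e = apex (M (T + n))"
    if e: "e \<in> arcs G" "initial_vertex e \<in> A" "terminal_vertex e \<notin> A" for e
  proof -
    obtain i where "e \<in> edges (M i)" using e(1) by auto
    then have "e \<in> edges (M (max i (T + n)))" using kmsw_mono(2)[of i "max i (T + n)"] by auto
    moreover have "e \<notin> edges (M (T + n))" using cl e by blast
    moreover have "initial_vertex e \<in> vertices (M (T + n))" using e A by blast
    ultimately have "initial_vertex e \<in> front (M (T + n))"
      using later_arc_from_front[of "T + n" "max i (T + n)"] by auto
    then show ?thesis using fr e(2) by blast
  qed
  with A r show ?thesis using that[of "T + n" A] by simp
qed

text \<open>Every vertex of \<open>M J\<close> leads to the apex, so a path to \<open>w\<close> that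
  leaves \<open>A\<close> through the apex would close a directed cycle. Paths therefore stay in the
  finite set \<open>A\<close>, and acyclicity bounds their length.\<close>

lemma finite_path_lengths: "finite (path_lengths G u w)"
proof (cases "u \<in> verts G \<and> w \<in> verts G")
  case False
  then have "path_lengths G u w = {}"
    using directed_path_verts[OF wf_G] unfolding path_lengths_def by blast
  then show ?thesis by simp
next
  case True
  then obtain T where T: "{u, w} \<subseteq> vertices (M T)"
    using finite_verts_bound[of "{u, w}"] by blast
  obtain J A where J: "T \<le> J" "vertices (M T) \<subseteq> A" "A \<subseteq> vertices (M J)" "upper_right (M J) = []"
    and ex: "\<And>e. e \<in> arcs G \<Longrightarrow> initial_vertex e \<in> A \<Longrightarrow> terminal_vertex e \<notin> A \<Longrightarrow> initial_vertex e = apex (M J)"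
    by (rule cut_exists[of T]) blast
  have fin: "finite A" using J(3) finite_vertices finite_subset by blast
  obtain r where r: "directed_path G w r (apex (M J))"
    using path_to_last_vertex[of w J] T J by (auto simp: last_vertex_def)
  have "length p \<le> card A" if p: "directed_path G u p w" for p
  proof (rule path_length_le[OF p fin], rule ccontr)
    assume "\<not> terminal_vertex ` set p \<subseteq> A"
    moreover have "u \<in> A" using T J by blast
    ultimately obtain e p2 where e: "directed_path G (initial_vertex e) (e # p2) w" "e \<in> arcs G"
        "initial_vertex e \<in> A" "terminal_vertex e \<notin> A"
      using path_exit[OF p] by metis
    from ex[OF e(2-4)] e(1) have "directed_path G (apex (M J)) (e # p2) w" by simp
    from digraph_acyclic[OF directed_path_appendI[OF this r]] show False by simp
  qed
  then have "path_lengths G u w \<subseteq> {..card A}" by (auto simp: path_lengths_def)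
  then show ?thesis by (rule finite_subset) simp
qed

lemma cut_vertex:
  assumes "finite F" "F \<subseteq> verts G"
  shows "\<exists>v C. finite C \<and> (\<forall>u w p. u \<in> F \<longrightarrow> w \<notin> C \<longrightarrow> directed_path G u p w \<longrightarrow>
        (\<exists>p1 p2. p = p1 @ p2 \<and> directed_path G u p1 v \<and> directed_path G v p2 w))"
proof -
  obtain T where T: "F \<subseteq> vertices (M T)" using finite_verts_bound[OF assms] .
  obtain J A where J: "T \<le> J" "vertices (M T) \<subseteq> A" "A \<subseteq> vertices (M J)" "upper_right (M J) = []"
    and ex: "\<And>e. e \<in> arcs G \<Longrightarrow> initial_vertex e \<in> A \<Longrightarrow> terminal_vertex e \<notin> A \<Longrightarrow> initial_vertex e = apex (M J)"
    by (rule cut_exists[of T]) blast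
  have "\<exists>p1 p2. p = p1 @ p2 \<and> directed_path G u p1 (apex (M J)) \<and> directed_path G (apex (M J)) p2 w"
    if u: "u \<in> F" and w: "w \<notin> vertices (M J)" and p: "directed_path G u p w" for u w p
  proof -
    have uA: "u \<in> A" using u T J by blast
    have "\<not> terminal_vertex ` set p \<subseteq> A"
    proof
      assume *: "terminal_vertex ` set p \<subseteq> A"
      have "w \<in> A"
      proof (cases p rule: rev_cases)
        case Nil
        with p uA show ?thesis by simp
      next
        case (snoc q e)
        with p have "w = terminal_vertex e" by (auto simp: directed_path_append pre_digraph.cas.simps)
        with snoc * show ?thesis by auto
      qed
      with J w show False by blast
    qed
    then obtain p1 e p2 where e: "p = p1 @ e # p2" "directed_path G u p1 (initial_vertex e)"
      "directed_path G (initial_vertex e) (e # p2) w" "e \<in> arcs G" "initial_vertex e \<in> A" "terminal_vertex e \<notin> A"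
      using path_exit[OF p uA] by metis
    with ex[OF e(4-6)] show ?thesis by auto
  qed
  then show ?thesis using finite_vertices[of J] by (intro exI[of _ "apex (M J)"] exI[of _ "vertices (M J)"]) blast
qed

text \<open>Each extension to the east creates a new last vertex, to which all earlier vertices
  lead.\<close>

lemma infinite_common_reach:
  assumes "u \<in> verts G" "v \<in> verts G"
  shows "infinite {w. (\<exists>p. directed_path G u p w) \<and> (\<exists>p. directed_path G v p w)}"
  unfolding infinite_nat_iff_unbounded
proof
  fix N
  obtain T where T: "{u, v} \<subseteq> vertices (M T)" using finite_verts_bound[of "{u, v}"] assms by blast
  obtain i where i: "i \<ge> max T N" "upper_right (M i) = []" "inc i = (1,-1)" using east_recurrent by blast
  have l: "last_vertex (Suc i) = Suc (Suc i)"
    by (cases rule: step_cases[of i]) (use i in \<open>auto simp: last_vertex_def apex_def active_def\<close>)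
  have "u \<in> vertices (M (Suc i))" "v \<in> vertices (M (Suc i))" using T kmsw_mono(1)[of T "Suc i"] i by auto
  from this[THEN path_to_last_vertex] have "Suc (Suc i) \<in> {w. (\<exists>p. directed_path G u p w) \<and> (\<exists>p. directed_path G v p w)}"
    by (simp add: l)
  moreover have "Suc (Suc i) > N" using i by simp
  ultimately show "\<exists>n>N. n \<in> {w. (\<exists>p. directed_path G u p w) \<and> (\<exists>p. directed_path G v p w)}" by blast
qed

text \<open>Recurrence makes both halves of the lower boundary infinite, so each
  \<open>LEAST\<close> in the definition is attained.\<close>

lemma boundary_vertex_in_verts: "boundary_vertex W k \<in> verts G"
proof -
  have R: "\<exists>j. i < length (lower_right (M j))" for i
  proof (induction i)
    case 0
    show ?case by (intro exI[of _ 0]) (simp add: kmsw_init_def)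
  next
    case (Suc i)
    then obtain j where j: "i < length (lower_right (M j))" ..
    obtain l where l: "l \<ge> j" "upper_right (M l) = []" "inc l = (1,-1)" using east_recurrent by blast
    have "length (lower_right (M (Suc l))) = Suc (length (lower_right (M l)))"
      by (cases rule: step_cases[of l]) (use l in auto)
    with j kmsw_mono(5)[OF l(1)] show ?case by (intro exI[of _ "Suc l"]) simp
  qed
  have L: "\<exists>j. i < length (lower_left (M j))" for i
  proof (induction i)
    case 0
    obtain l where l: "length (upper_left (M l)) = 1" "inc l = (-1,0)" using west_recurrent by blast
    have "length (lower_left (M (Suc l))) = Suc (length (lower_left (M l)))"
      by (cases rule: step_cases[of l]) (use l in auto)
    then show ?case by (intro exI[of _ "Suc l"]) simp
  next
    case (Suc i)
    then obtain j where j: "i < length (lower_left (M j))" ..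
    obtain l where l: "l \<ge> j" "length (upper_left (M l)) = 1" "inc l = (-1,0)" using west_recurrent by blast
    have "length (lower_left (M (Suc l))) = Suc (length (lower_left (M l)))"
      by (cases rule: step_cases[of l]) (use l in auto)
    with j kmsw_mono(4)[OF l(1)] show ?case by (intro exI[of _ "Suc l"]) simp
  qed
  show ?thesis
  proof (cases "k \<ge> 0")
    case True
    define j where "j = (LEAST j. nat k < length (lower_right (M j)))"
    have "nat k < length (lower_right (M j))" unfolding j_def by (rule LeastI_ex) (rule R)
    then have "lower_right (M j) ! nat k \<in> edges (M j)" using lower_right_edges nth_mem by blast
    then show ?thesis using edge_vertices(1) True
      by (auto simp: boundary_vertex_def lower_right_edge_def simp flip: j_def)
  next
    case False
    define j where "j = (LEAST j. nat (- k - 1) < length (lower_left (M j)))"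
    have "nat (- k - 1) < length (lower_left (M j))" unfolding j_def by (rule LeastI_ex) (rule L)
    then have "rev (lower_left (M j)) ! nat (- k - 1) \<in> set (lower_left (M j))"
      using nth_mem[of _ "rev (lower_left (M j))"] by simp
    then show ?thesis using edge_vertices(1)[of _ j] False
      by (auto simp: boundary_vertex_def lower_left_edge_def simp flip: j_def)
  qed
qed

lemmas Busemann_function_unique_exists =
  Busemann_function_unique_exists[OF _ wf_G finite_path_lengths boundary_vertex_in_verts cut_vertex infinite_common_reach]

end

section \<open>The random walk\<close>

text \<open>Peels off the first increment instead of the last, as the recursion of
  \<open>survival\<close> does.\<close>

lemma run_Suc_shift: "run F c x (Suc n) = run F (\<lambda>i. c (Suc i)) (F (c 0) x) n"
  by (induction n) auto

lemma measurable_run: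
  fixes c :: "nat \<Rightarrow> 'w \<Rightarrow> int \<times> int"
  assumes "\<And>i. c i \<in> measurable M (count_space UNIV)"
  shows "(\<lambda>\<omega>. run F (\<lambda>i. c i \<omega>) x n) \<in> measurable M (count_space UNIV)"
proof (induction n)
  case (Suc n)
  have "(\<lambda>\<omega>. F d (run F (\<lambda>i. c i \<omega>) x n)) \<in> measurable M (count_space UNIV)" for d
    by (rule measurable_compose[OF Suc]) simp
  from measurable_compose_countable[OF this assms[of n]] show ?case by simp
qed simp

context prob_space
begin

text \<open>Passes from the increments of the bi-infinite walk to those after time 0.\<close>

lemma indep_vars_reindex:
  assumes "inj_on h I" "indep_vars N X (h ` I)"
  shows "indep_vars (\<lambda>i. N (h i)) (\<lambda>i. X (h i)) I"
proof -
  let ?F = "\<lambda>i. {X i -` A \<inter> space M |A. A \<in> sets (N i)}"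
  from assms(2) have X: "\<And>i. i \<in> I \<Longrightarrow> X (h i) \<in> measurable M (N (h i))" and F: "indep_sets ?F (h ` I)"
    by (auto simp: indep_vars_def2)
  have "indep_sets (\<lambda>i. ?F (h i)) I"
  proof (rule indep_setsI)
    show "?F (h i) \<subseteq> events" if "i \<in> I" for i using F that unfolding indep_sets_def by blast
    fix A J assume J: "J \<noteq> {}" "J \<subseteq> I" "finite J" "\<forall>j\<in>J. A j \<in> ?F (h j)"
    have inj: "inj_on h J" using assms(1) J(2) by (rule inj_on_subset)
    have "prob (\<Inter>j\<in>h ` J. A (inv_into J h j)) = (\<Prod>j\<in>h ` J. prob (A (inv_into J h j)))"
      using J inj by (intro indep_setsD[OF F]) (auto simp: inv_into_f_f)
    then show "prob (\<Inter>j\<in>J. A j) = (\<Prod>j\<in>J. prob (A j))"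
      using inj by (simp add: prod.reindex inv_into_f_f image_image cong: INF_cong prod.cong)
  qed
  with X show ?thesis by (simp add: indep_vars_def2)
qed

section \<open>Independent uniform increments\<close>

context
  fixes \<xi> :: "nat \<Rightarrow> 'a \<Rightarrow> int \<times> int"
  assumes indep: "indep_vars (\<lambda>_. count_space UNIV) \<xi> UNIV"
    and uniform: "\<And>n. distr M (count_space UNIV) (\<xi> n) = measure_pmf (pmf_of_set kmsw_increments)"
begin

lemma measurable_increment [measurable]: "\<xi> n \<in> measurable M (count_space UNIV)"
  using indep by (auto simp: indep_vars_def)

lemma prob_increment:
  assumes "c \<in> kmsw_increments"
  shows "prob (\<xi> n -` {c} \<inter> space M) = 1 / 3"
proof -
  have "prob (\<xi> n -` {c} \<inter> space M) = measure (distr M (count_space UNIV) (\<xi> n)) {c}"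
    by (subst measure_distr) auto
  also have "\<dots> = pmf (pmf_of_set kmsw_increments) c"
    by (simp add: uniform pmf.rep_eq)
  also have "\<dots> = 1 / 3" using assms by (simp add: kmsw_increments_def)
  finally show ?thesis .
qed

lemma AE_increment: "AE \<omega> in M. \<xi> n \<omega> \<in> kmsw_increments"
proof -
  have "AE c in measure_pmf (pmf_of_set kmsw_increments). c \<in> kmsw_increments"
    by (subst AE_measure_pmf_iff) (simp add: kmsw_increments_def)
  then have "AE c in distr M (count_space UNIV) (\<xi> n). c \<in> kmsw_increments"
    by (simp only: uniform)
  then show ?thesis by (subst (asm) AE_distr_iff) auto
qed

definition cylinder :: "nat \<Rightarrow> (int \<times> int) list \<Rightarrow> 'a set" where
  "cylinder T cs = {\<omega> \<in> space M. \<forall>i<length cs. \<xi> (T + i) \<omega> = cs ! i}"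

lemma cylinder_sets [measurable]: "cylinder T cs \<in> events"
  unfolding cylinder_def by measurable

lemma prob_cylinder:
  assumes "set cs \<subseteq> kmsw_increments"
  shows "prob (cylinder T cs) = (1 / 3) ^ length cs"
proof (cases "cs = []")
  case True
  then show ?thesis by (simp add: cylinder_def prob_space)
next
  case False
  let ?J = "{T..<T + length cs}"
  have "cylinder T cs = (\<Inter>j\<in>?J. \<xi> j -` {cs ! (j - T)} \<inter> space M)" (is "_ = ?I")
  proof (intro set_eqI iffI)
    fix \<omega> assume "\<omega> \<in> ?I"
    moreover have "T \<in> ?J" using False by simp
    ultimately show "\<omega> \<in> cylinder T cs" by (fastforce simp: cylinder_def)
  next
    fix \<omega> assume *: "\<omega> \<in> cylinder T cs"
    show "\<omega> \<in> ?I"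
    proof
      fix j assume "j \<in> ?J"
      then have "j - T < length cs" "T + (j - T) = j" by auto
      with * show "\<omega> \<in> \<xi> j -` {cs ! (j - T)} \<inter> space M" by (force simp: cylinder_def)
    qed
  qed
  also have "prob \<dots> = (\<Prod>j\<in>?J. prob (\<xi> j -` {cs ! (j - T)} \<inter> space M))"
    using False by (intro indep_varsD[OF indep]) auto
  also have "\<dots> = (\<Prod>j\<in>?J. 1 / 3)"
  proof (intro prod.cong refl prob_increment)
    fix j assume "j \<in> ?J"
    then have "j - T < length cs" by auto
    then show "cs ! (j - T) \<in> kmsw_increments" using assms nth_mem by blast
  qed
  finally show ?thesis by simp
qed

text \<open>The cylinder replaces conditioning on the first increments: each induction step moves
  one more value into \<open>cs\<close>, at the price of the weight 1/3 in \<open>avg\<close>. As an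
  upper bound suffices, a union bound over the three values is enough.\<close>

lemma prob_run_avoids_le:
  assumes "set cs \<subseteq> kmsw_increments"
  shows "prob {\<omega> \<in> cylinder T cs. \<forall>m\<le>n. run F (\<lambda>i. \<xi> (T + length cs + i) \<omega>) x m \<noteq> t}
    \<le> (1 / 3) ^ length cs * survival F t n x"
  using assms
proof (induction n arbitrary: cs x)
  let ?A = "\<lambda>cs n x. {\<omega> \<in> cylinder T cs. \<forall>m\<le>n. run F (\<lambda>i. \<xi> (T + length cs + i) \<omega>) x m \<noteq> t}"
  have meas: "?A cs n x \<in> events" for cs n x
  proof -
    have run[measurable]: "(\<lambda>\<omega>. run F (\<lambda>i. \<xi> (T + length cs + i) \<omega>) x m) \<in> measurable M (count_space UNIV)" for m
      by (rule measurable_run) measurable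
    have "?A cs n x = cylinder T cs \<inter> {\<omega> \<in> space M. \<forall>m\<le>n. run F (\<lambda>i. \<xi> (T + length cs + i) \<omega>) x m \<noteq> t}"
      by (auto simp: cylinder_def)
    also have "\<dots> \<in> events" by measurable
    finally show ?thesis .
  qed
  {
    case 0
    show ?case
    proof (cases "x = t")
      case True
      then have "?A cs 0 x = {}" by auto
      with True show ?thesis by (simp only: measure_empty survival_target)
    next
      case False
      have "prob (?A cs 0 x) \<le> prob (cylinder T cs)" by (intro finite_measure_mono) auto
      with False show ?thesis by (simp add: prob_cylinder[OF 0])
    qed
  next
    case (Suc n)
    show ?case
    proof (cases "x = t")
      case True
      then have "?A cs (Suc n) x = {}" by auto
      with True show ?thesis by (simp only: measure_empty survival_target)
    next
      case False
      have sub: "AE \<omega> in M. \<omega> \<in> ?A cs (Suc n) x \<longrightarrow> \<omega> \<in> (\<Union>c\<in>kmsw_increments. ?A (cs @ [c]) n (F c x))"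
        using AE_increment[of "T + length cs"]
      proof (eventually_elim, intro impI)
        fix \<omega> assume c: "\<xi> (T + length cs) \<omega> \<in> kmsw_increments" and \<omega>: "\<omega> \<in> ?A cs (Suc n) x"
        let ?c = "\<xi> (T + length cs) \<omega>"
        have "\<omega> \<in> cylinder T (cs @ [?c])"
          using \<omega> by (auto simp: cylinder_def nth_append less_Suc_eq)
        moreover have "run F (\<lambda>i. \<xi> (T + length (cs @ [?c]) + i) \<omega>) (F ?c x) m \<noteq> t" if "m \<le> n" for m
        proof -
          have "run F (\<lambda>i. \<xi> (T + length cs + i) \<omega>) x (Suc m) \<noteq> t" using \<omega> that by blast
          then show ?thesis by (simp add: run_Suc_shift del: run.simps)
        qed
        ultimately show "\<omega> \<in> (\<Union>c\<in>kmsw_increments. ?A (cs @ [c]) n (F c x))" using c by blast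
      qed
      have fin: "finite kmsw_increments" by (simp add: kmsw_increments_def)
      have "prob (?A cs (Suc n) x) \<le> prob (\<Union>c\<in>kmsw_increments. ?A (cs @ [c]) n (F c x))"
        by (rule finite_measure_mono_AE[OF sub]) (intro sets.finite_UN fin meas)
      also have "\<dots> \<le> (\<Sum>c\<in>kmsw_increments. prob (?A (cs @ [c]) n (F c x)))"
        by (rule finite_measure_subadditive_finite[OF fin]) (rule image_subsetI, rule meas)
      also have "\<dots> \<le> (\<Sum>c\<in>kmsw_increments. (1 / 3) ^ length (cs @ [c]) * survival F t n (F c x))"
        using Suc.prems by (intro sum_mono Suc.IH) auto
      also have "\<dots> = (1 / 3) ^ length cs * survival F t (Suc n) x"
        using False by (simp add: kmsw_increments_def avg_def field_simps)
      finally show ?thesis .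
    qed
  }
qed

lemma AE_run_hits:
  assumes "(\<lambda>n. survival F t n x) \<longlonglongrightarrow> 0"
  shows "AE \<omega> in M. \<exists>n. run F (\<lambda>i. \<xi> (T + i) \<omega>) x n = t"
proof -
  let ?N = "\<lambda>n. {\<omega> \<in> space M. \<forall>m\<le>n. run F (\<lambda>i. \<xi> (T + i) \<omega>) x m \<noteq> t}"
  have run[measurable]: "(\<lambda>\<omega>. run F (\<lambda>i. \<xi> (T + i) \<omega>) x m) \<in> measurable M (count_space UNIV)" for m
    by (rule measurable_run) measurable
  have N: "?N n \<in> events" for n by measurable
  have le: "prob (?N n) \<le> survival F t n x" for n
    using prob_run_avoids_le[of "[]" T n F x t] by (simp add: cylinder_def)
  have "prob (\<Inter>n. ?N n) \<le> survival F t n x" for n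
    by (rule order_trans[OF finite_measure_mono le]) (use N in auto)
  then have "prob (\<Inter>n. ?N n) \<le> 0" by (intro LIMSEQ_le_const[OF assms] exI allI impI)
  then have "prob (\<Inter>n. ?N n) = 0" by (simp add: measure_le_0_iff)
  then have "(\<Inter>n. ?N n) \<in> null_sets M" using N by (intro null_setsI) (auto simp: emeasure_eq_measure)
  then show ?thesis
    by (rule AE_I') auto
qed

end

end

theorem theorem1p4:
  fixes M :: "'w measure"
    and Z :: "int \<Rightarrow> 'w \<Rightarrow> int \<times> int"
    and XDP :: "(nat, edge) pre_digraph \<Rightarrow> nat \<Rightarrow> nat \<Rightarrow> ereal"
  assumes "prob_space M"
    and start: "\<And>\<omega>. \<omega> \<in> space M \<Longrightarrow> Z 0 \<omega> = (0, 0)"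
    and indep: "prob_space.indep_vars M (\<lambda>_. count_space UNIV) (\<lambda>n \<omega>. Z n \<omega> - Z (n - 1) \<omega>) UNIV"
    and uniform: "\<And>n. distr M (count_space UNIV) (\<lambda>\<omega>. Z n \<omega> - Z (n - 1) \<omega>)
                        = measure_pmf (pmf_of_set kmsw_increments)"
    and XDP: "XDP \<in> {LDP, SDP}"
  shows "AE \<omega> in M.
    let W = (\<lambda>j. Z (int j) \<omega>);
        G = digraph_of (kmsw_union W);
        x = boundary_vertex W
    in \<exists>!X :: int \<Rightarrow> int. X 0 = 0 \<and>
         (\<forall>k k'. \<forall>w :: nat \<Rightarrow> nat.
            inj w \<and> range w \<subseteq> verts G \<and>
            (\<forall>j. (\<exists>p. directed_path G (x k) p (w j)) \<and> (\<exists>p. directed_path G (x k') p (w j))) \<longrightarrow>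
            (\<forall>\<^sub>F j in sequentially.
               ereal (real_of_int (X k' - X k)) = XDP G (x k') (w j) - XDP G (x k) (w j)))"
proof -
  interpret prob_space M by fact
  define \<xi> where "\<xi> n = (\<lambda>\<omega>. Z (int (Suc n)) \<omega> - Z (int n) \<omega>)" for n
  have \<xi>_eq: "\<xi> n = (\<lambda>\<omega>. Z (int (Suc n)) \<omega> - Z (int (Suc n) - 1) \<omega>)" for n by (simp add: \<xi>_def)
  have \<xi>_indep: "indep_vars (\<lambda>_. count_space UNIV) \<xi> UNIV"
    unfolding \<xi>_eq
    by (rule indep_vars_reindex[where h = "\<lambda>n. int (Suc n)"])
      (use indep in \<open>auto intro: inj_onI indep_vars_subset\<close>)
  have \<xi>_uniform: "distr M (count_space UNIV) (\<xi> n) = measure_pmf (pmf_of_set kmsw_increments)" for n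
    unfolding \<xi>_eq by (rule uniform)
  note AE_hits = AE_run_hits[OF \<xi>_indep \<xi>_uniform]
  have "AE \<omega> in M. \<forall>n. \<xi> n \<omega> \<in> kmsw_increments"
    using AE_increment[OF \<xi>_indep \<xi>_uniform] by (simp add: AE_all_countable)
  \<comment> \<open>The state of the map at time \<open>T\<close> is random. Since there are
    countably many times and states, hitting holds almost surely from all of them at once, which
    replaces a Markov property at time \<open>T\<close>.\<close>
  moreover have "AE \<omega> in M. \<forall>T k. \<exists>n. run east_step (\<lambda>i. \<xi> (T + i) \<omega>) k n = 0"
    using AE_hits[OF survival_east] by (simp add: AE_all_countable)
  moreover have "AE \<omega> in M. \<forall>T k. \<exists>n. run west_step (\<lambda>i. \<xi> (T + i) \<omega>) k n = 0"
    using AE_hits[OF survival_west] by (simp add: AE_all_countable)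
  moreover have "AE \<omega> in M. \<forall>T p q. \<exists>n. run front_step (\<lambda>i. \<xi> (T + i) \<omega>) (int p + 1, q) n = (1, 0)"
    using AE_hits[OF survival_front] by (simp add: AE_all_countable)
  ultimately show ?thesis
  proof eventually_elim
    case (elim \<omega>)
    define W where "W = (\<lambda>j. Z (int j) \<omega>)"
    have inc: "W (Suc n) - W n = \<xi> n \<omega>" for n by (simp add: W_def \<xi>_def)
    interpret kmsw_walk W
      by unfold_locales (use elim(1) inc in simp)
    interpret recurrent_kmsw_walk W
    proof
      fix T
      show "\<exists>i\<ge>T. upper_right (kmsw W i) = [] \<and> inc i = (1,-1)"
        using elim(2) east_growth[of T] by (auto simp: inc)
      show "\<exists>i\<ge>T. length (upper_left (kmsw W i)) = 1 \<and> inc i = (-1,0)"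
        using elim(3) west_growth[of T] by (auto simp: inc)
      show "\<exists>n. run front_step (\<lambda>n. inc (T + n)) (int (length (upper_left (kmsw W T))) + 1, length (upper_right (kmsw W T))) n = (1, 0)"
        using elim(4) by (simp add: inc)
    qed
    show ?case
      unfolding Let_def W_def[symmetric] by (rule Busemann_function_unique_exists[OF XDP])
  qed
qed

end
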